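(* If $H$ is a subgroup of $PL_o(I)$ and $H$ is isomorphic to a standard restricted wreath product $C\wr T$ of nontrivial groups $C$ and $T$, then $T\cong\mathbf{Z}$.
   Context: $I=[0,1]$. $PL_o(I)$ is the group, under composition, of orientation-preserving piecewise-linear homeomorphisms of $I$ with finitely many breaks in slope. The standard restricted wreath product $C\wr T$ is the semidirect product $\left(\bigoplus_{t\in T}C\right)\rtimes T$, where $\bigoplus_{t\in T} C$ (the base group) is the group of finitely supported functions $T\to C$ and $T$ (the top group) acts by translating coordinates via its regular action on itself. *)

theory Defs
  imports "HOL-Analysis.Analysis" "HOL-Algebra.Bij" "HOL-Algebra.Product_Groups"
    "HOL-Algebra.Elementary_Groups"
begin

text \<open>
  The finite set \<open>B\<close> contains the breaks of \<open>f\<close> (it may also contain further points):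
  \<open>f\<close> is affine on every compact subinterval of \<open>[a, b]\<close> whose interior avoids \<open>B\<close>.
\<close>
definition piecewise_linear_on :: "real \<Rightarrow> real \<Rightarrow> (real \<Rightarrow> real) \<Rightarrow> bool" where
  "piecewise_linear_on a b f \<longleftrightarrow>
     (\<exists>B. finite B \<and>
        (\<forall>u v. a \<le> u \<and> u < v \<and> v \<le> b \<and> {u<..<v} \<inter> B = {} \<longrightarrow>
           (\<exists>m c. \<forall>x\<in>{u..v}. f x = m * x + c)))"

text \<open>Following \<^const>\<open>Bij\<close>, maps of \<open>[0, 1]\<close> are represented by extensional functions.\<close>
definition PL\<^sub>o_set :: "(real \<Rightarrow> real) set" where
  "PL\<^sub>o_set = {f \<in> Bij {0..1}. (\<exists>g. homeomorphism {0..1} {0..1} f g)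
                 \<and> strict_mono_on {0..1} f \<and> piecewise_linear_on 0 1 f}"

definition PL\<^sub>o :: "(real \<Rightarrow> real) monoid" where
  "PL\<^sub>o = (BijGroup {0..1})\<lparr>carrier := PL\<^sub>o_set\<rparr>"

definition semidirect_product ::
  "('n, 'k) monoid_scheme \<Rightarrow> ('t, 'l) monoid_scheme \<Rightarrow> ('t \<Rightarrow> 'n \<Rightarrow> 'n) \<Rightarrow> ('n \<times> 't) monoid" where
  "semidirect_product N T \<phi> =
     \<lparr>carrier = carrier N \<times> carrier T,
      mult = (\<lambda>(a, s) (b, t). (a \<otimes>\<^bsub>N\<^esub> \<phi> s b, s \<otimes>\<^bsub>T\<^esub> t)),
      one = (\<one>\<^bsub>N\<^esub>, \<one>\<^bsub>T\<^esub>)\<rparr>"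

definition wreath_base ::
  "('c, 'k) monoid_scheme \<Rightarrow> ('t, 'l) monoid_scheme \<Rightarrow> ('t \<Rightarrow> 'c) monoid" where
  "wreath_base C T = sum_group (carrier T) (\<lambda>_. C)"

definition translate ::
  "('c, 'k) monoid_scheme \<Rightarrow> ('t, 'l) monoid_scheme \<Rightarrow> 't \<Rightarrow> ('t \<Rightarrow> 'c) \<Rightarrow> ('t \<Rightarrow> 'c)" where
  "translate C T t = (\<lambda>f\<in>carrier (wreath_base C T). \<lambda>s\<in>carrier T. f (inv\<^bsub>T\<^esub> t \<otimes>\<^bsub>T\<^esub> s))"

definition wreath_product ::
  "('c, 'k) monoid_scheme \<Rightarrow> ('t, 'l) monoid_scheme \<Rightarrow> (('t \<Rightarrow> 'c) \<times> 't) monoid" where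
  "wreath_product C T = semidirect_product (wreath_base C T) T (translate C T)"

lemma PL\<^sub>o_setD:
  assumes "f \<in> PL\<^sub>o_set"
  shows "f \<in> Bij {0..1}" "bij_betw f {0..1} {0..1}" "strict_mono_on {0..1} f"
    "continuous_on {0..1} f" "piecewise_linear_on 0 1 f"
  using assms unfolding PL\<^sub>o_set_def Bij_def homeomorphism_def by blast+

lemma PL\<^sub>o_setI:
  assumes "f \<in> Bij {0..1}" "strict_mono_on {0..1} f" "continuous_on {0..1} f"
    "piecewise_linear_on 0 1 f"
  shows "f \<in> PL\<^sub>o_set"
proof -
  have "\<exists>g. homeomorphism {0..1} {0..1} f g"
    using assms homeomorphism_compact[of "{0..1}" f "{0..1}"]
    by (auto simp: Bij_def bij_betw_def)
  then show ?thesis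
    using assms by (auto simp: PL\<^sub>o_set_def)
qed

lemma piecewise_linear_on_cong:
  assumes "piecewise_linear_on a b f" "\<And>x. x \<in> {a..b} \<Longrightarrow> f x = g x"
  shows "piecewise_linear_on a b g"
proof -
  obtain B where B: "finite B" "\<And>u v. a \<le> u \<and> u < v \<and> v \<le> b \<and> {u<..<v} \<inter> B = {} \<Longrightarrow>
           (\<exists>m c. \<forall>x\<in>{u..v}. f x = m * x + c)"
    using assms(1) unfolding piecewise_linear_on_def by blast
  have "\<exists>m c. \<forall>x\<in>{u..v}. g x = m * x + c"
    if uv: "a \<le> u \<and> u < v \<and> v \<le> b \<and> {u<..<v} \<inter> B = {}" for u v
  proof -
    obtain m c where "\<forall>x\<in>{u..v}. f x = m * x + c" using B(2)[OF uv] by blast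
    then have "\<forall>x\<in>{u..v}. g x = m * x + c" using uv assms(2) by force
    then show ?thesis by blast
  qed
  with B(1) show ?thesis unfolding piecewise_linear_on_def by blast
qed

lemma strict_mono_on_01_iff:
  fixes f :: "real \<Rightarrow> real"
  assumes "strict_mono_on {0..1} f" "x \<in> {0..1}" "y \<in> {0..1}"
  shows "f x < f y \<longleftrightarrow> x < y" "f x \<le> f y \<longleftrightarrow> x \<le> y"
  using strict_mono_onD[OF assms(1,2,3)] strict_mono_onD[OF assms(1,3,2)]
  by (cases x y rule: linorder_cases; force)+

lemma PL\<^sub>o_compose:
  assumes f: "f \<in> PL\<^sub>o_set" and g: "g \<in> PL\<^sub>o_set"
  shows "compose {0..1} g f \<in> PL\<^sub>o_set"
proof (rule PL\<^sub>o_setI)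
  note F = PL\<^sub>o_setD[OF f] and G = PL\<^sub>o_setD[OF g]
  have img: "f x \<in> {0..1}" if "x \<in> {0..1}" for x
    using F(2) that by (auto simp: bij_betw_def)
  show "compose {0..1} g f \<in> Bij {0..1}" by (rule compose_Bij[OF G(1) F(1)])
  show "strict_mono_on {0..1} (compose {0..1} g f)"
    by (rule strict_mono_onI) (simp add: compose_def strict_mono_on_01_iff[OF G(3)] strict_mono_on_01_iff[OF F(3)] img del: atLeastAtMost_iff)
  have "continuous_on {0..1} (g \<circ> f)"
    by (rule continuous_on_compose[OF F(4)]) (use F(2) G(4) in \<open>simp add: bij_betw_def\<close>)
  then show "continuous_on {0..1} (compose {0..1} g f)"
    by (rule continuous_on_eq) (simp add: compose_def)
  obtain A where A: "finite A" "\<And>u v. 0 \<le> u \<and> u < v \<and> v \<le> 1 \<and> {u<..<v} \<inter> A = {} \<Longrightarrow>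
           (\<exists>m c. \<forall>x\<in>{u..v}. f x = m * x + c)"
    using F(5) unfolding piecewise_linear_on_def by blast
  obtain B where B: "finite B" "\<And>u v. 0 \<le> u \<and> u < v \<and> v \<le> 1 \<and> {u<..<v} \<inter> B = {} \<Longrightarrow>
           (\<exists>m c. \<forall>x\<in>{u..v}. g x = m * x + c)"
    using G(5) unfolding piecewise_linear_on_def by blast
  let ?D = "A \<union> (f -` B \<inter> {0..1})"
  have "finite ?D"
    using A(1) B(1) F(2) by (simp add: bij_betw_def finite_vimage_IntI)
  moreover have "\<exists>m c. \<forall>x\<in>{u..v}. compose {0..1} g f x = m * x + c"
    if uv: "0 \<le> u \<and> u < v \<and> v \<le> 1 \<and> {u<..<v} \<inter> ?D = {}" for u v
  proof -
    have m: "u \<in> {0..1}" "v \<in> {0..1}" using uv by auto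
    obtain m c where mc: "\<And>x. x \<in> {u..v} \<Longrightarrow> f x = m * x + c"
      using A(2)[of u v] uv by blast
    have "{f u<..<f v} \<inter> B = {}"
    proof (rule ccontr)
      assume "{f u<..<f v} \<inter> B \<noteq> {}"
      then obtain y where y: "f u < y" "y < f v" "y \<in> B" by auto
      then have "y \<in> {0..1}" using img[OF m(1)] img[OF m(2)] by auto
      then obtain x where x: "x \<in> {0..1}" "y = f x" using F(2) unfolding bij_betw_def by blast
      with y m have "u < x" "x < v" using strict_mono_on_01_iff[OF F(3)] by auto
      with uv x y show False by auto
    qed
    moreover have "0 \<le> f u" "f v \<le> 1" "f u < f v"
      using img m uv strict_mono_on_01_iff[OF F(3) m] by auto
    ultimately obtain n d where nd: "\<And>y. y \<in> {f u..f v} \<Longrightarrow> g y = n * y + d"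
      using B(2)[of "f u" "f v"] by blast
    have "compose {0..1} g f x = (n * m) * x + (n * c + d)" if x: "x \<in> {u..v}" for x
    proof -
      have x01: "x \<in> {0..1}" using x uv by auto
      then have "f x \<in> {f u..f v}"
        using x m strict_mono_on_01_iff(2)[OF F(3)] by auto
      then show ?thesis
        using nd[of "f x"] mc[OF x] x01 by (simp add: compose_def algebra_simps)
    qed
    then show ?thesis by blast
  qed
  ultimately show "piecewise_linear_on 0 1 (compose {0..1} g f)"
    unfolding piecewise_linear_on_def by blast
qed

lemma PL\<^sub>o_inverse:
  assumes f: "f \<in> PL\<^sub>o_set"
  shows "(\<lambda>x\<in>{0..1}. inv_into {0..1} f x) \<in> PL\<^sub>o_set"
proof (rule PL\<^sub>o_setI)
  note F = PL\<^sub>o_setD[OF f]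
  let ?g = "inv_into {0..1} f"
  have gin: "?g y \<in> {0..1}" and fg: "f (?g y) = y" if "y \<in> {0..1}" for y
    using that F(2) by (metis bij_betw_def inv_into_into, metis bij_betw_inv_into_right)
  have gf: "?g (f x) = x" if "x \<in> {0..1}" for x
    using that F(2) by (meson bij_betw_inv_into_left)
  show "restrict ?g {0..1} \<in> Bij {0..1}" by (rule restrict_inv_into_Bij[OF F(1)])
  show "strict_mono_on {0..1} (restrict ?g {0..1})"
    by (rule strict_mono_onI)
       (simp add: strict_mono_on_01_iff(1)[OF F(3), symmetric] gin fg del: atLeastAtMost_iff)
  have "continuous_on (f ` {0..1}) ?g"
    by (rule continuous_on_inv[OF F(4)]) (auto simp: gf)
  then have "continuous_on {0..1} ?g" using F(2) by (simp add: bij_betw_def)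
  then show "continuous_on {0..1} (restrict ?g {0..1})"
    by (rule continuous_on_eq) simp
  obtain A where A: "finite A" "\<And>u v. 0 \<le> u \<and> u < v \<and> v \<le> 1 \<and> {u<..<v} \<inter> A = {} \<Longrightarrow>
           (\<exists>m c. \<forall>x\<in>{u..v}. f x = m * x + c)"
    using F(5) unfolding piecewise_linear_on_def by blast
  have "\<exists>m c. \<forall>y\<in>{u..v}. restrict ?g {0..1} y = m * y + c"
    if uv: "0 \<le> u \<and> u < v \<and> v \<le> 1 \<and> {u<..<v} \<inter> f ` A = {}" for u v
  proof -
    have m: "u \<in> {0..1}" "v \<in> {0..1}" using uv by auto
    have lt: "?g u < ?g v"
      using strict_mono_on_01_iff(1)[OF F(3) gin[OF m(1)] gin[OF m(2)]] fg m uv by auto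
    have "{?g u<..<?g v} \<inter> A = {}"
    proof (rule ccontr)
      assume "{?g u<..<?g v} \<inter> A \<noteq> {}"
      then obtain x where x: "?g u < x" "x < ?g v" "x \<in> A" by auto
      then have x01: "x \<in> {0..1}" using gin[OF m(1)] gin[OF m(2)] by auto
      have "u < f x" "f x < v"
        using x x01 strict_mono_on_01_iff(1)[OF F(3)] gin fg m by metis+
      with uv x show False by auto
    qed
    then obtain a c where ac: "\<And>x. x \<in> {?g u..?g v} \<Longrightarrow> f x = a * x + c"
      using A(2)[of "?g u" "?g v"] lt gin[OF m(1)] gin[OF m(2)] by auto
    have "a * ?g u + c = u" "a * ?g v + c = v"
      using ac[of "?g u"] ac[of "?g v"] fg m lt by auto
    then have "a \<noteq> 0" using uv by auto
    have "restrict ?g {0..1} y = (1 / a) * y + (- c / a)" if y: "y \<in> {u..v}" for y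
    proof -
      have y01: "y \<in> {0..1}" using y uv by auto
      have "?g u \<le> ?g y" "?g y \<le> ?g v"
        using strict_mono_on_01_iff(2)[OF F(3) gin[OF m(1)] gin[OF y01]]
          strict_mono_on_01_iff(2)[OF F(3) gin[OF y01] gin[OF m(2)]] fg[OF m(1)] fg[OF m(2)]
          fg[OF y01] y
        by simp_all
      then have "y = a * ?g y + c" using ac[of "?g y"] fg[OF y01] by auto
      then have "?g y = (y - c) / a" using \<open>a \<noteq> 0\<close> by (auto simp: field_simps)
      then show ?thesis using y01 by (simp add: diff_divide_distrib)
    qed
    then show ?thesis by blast
  qed
  then show "piecewise_linear_on 0 1 (restrict ?g {0..1})"
    unfolding piecewise_linear_on_def using A(1) by blast
qed

lemma PL\<^sub>o_id: "(\<lambda>x\<in>{0..1}. x) \<in> PL\<^sub>o_set"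
proof (rule PL\<^sub>o_setI)
  show "continuous_on {0..1} (\<lambda>x\<in>{0..1::real}. x)"
    by (rule continuous_on_eq[OF continuous_on_id]) simp
  have "piecewise_linear_on 0 1 (\<lambda>x. x)"
    unfolding piecewise_linear_on_def
    by (intro exI[of _ "{}"] conjI allI impI exI[of _ 1] exI[of _ 0]) auto
  then show "piecewise_linear_on 0 1 (\<lambda>x\<in>{0..1}. x)"
    by (rule piecewise_linear_on_cong) simp
qed (auto simp: id_Bij strict_mono_on_def)

lemma subgroup_PL\<^sub>o: "subgroup PL\<^sub>o_set (BijGroup {0..1})"
proof (rule group.subgroupI[OF group_BijGroup])
  show "PL\<^sub>o_set \<subseteq> carrier (BijGroup {0..1})"
    by (auto simp: BijGroup_def PL\<^sub>o_set_def)
  show "PL\<^sub>o_set \<noteq> {}" using PL\<^sub>o_id by blast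
  show "inv\<^bsub>BijGroup {0..1}\<^esub> f \<in> PL\<^sub>o_set" if "f \<in> PL\<^sub>o_set" for f
    using that PL\<^sub>o_inverse[OF that] PL\<^sub>o_setD(1)[OF that] by (simp add: inv_BijGroup)
  show "g \<otimes>\<^bsub>BijGroup {0..1}\<^esub> f \<in> PL\<^sub>o_set" if "g \<in> PL\<^sub>o_set" "f \<in> PL\<^sub>o_set" for g f
    using PL\<^sub>o_compose[OF that(2,1)] that[THEN PL\<^sub>o_setD(1)] by (simp add: BijGroup_def)
qed

lemma group_PL\<^sub>o: "Group.group PL\<^sub>o"
  unfolding PL\<^sub>o_def by (rule subgroup.subgroup_is_group[OF subgroup_PL\<^sub>o group_BijGroup])

lemma group_semidirect_product:
  assumes "Group.group N" "Group.group T" and \<phi>: "\<phi> \<in> hom T (AutoGroup N)"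
  shows "Group.group (semidirect_product N T \<phi>)"
proof -
  interpret N: Group.group N by fact
  interpret T: Group.group T by fact
  have aut: "\<phi> t \<in> auto N" if "t \<in> carrier T" for t
    using that \<phi> by (auto simp: hom_def AutoGroup_def)
  then have cl: "\<phi> t a \<in> carrier N" if "t \<in> carrier T" "a \<in> carrier N" for t a
    using that by (auto simp: auto_def hom_def)
  have mlt: "\<phi> t (a \<otimes>\<^bsub>N\<^esub> b) = \<phi> t a \<otimes>\<^bsub>N\<^esub> \<phi> t b"
    if "t \<in> carrier T" "a \<in> carrier N" "b \<in> carrier N" for t a b
    using that aut by (auto simp: auto_def hom_def)
  have cmp: "\<phi> (s \<otimes>\<^bsub>T\<^esub> t) a = \<phi> s (\<phi> t a)"
    if "s \<in> carrier T" "t \<in> carrier T" "a \<in> carrier N" for s t a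
  proof -
    have "\<phi> (s \<otimes>\<^bsub>T\<^esub> t) = \<phi> s \<otimes>\<^bsub>AutoGroup N\<^esub> \<phi> t"
      using \<phi> that by (auto simp: hom_def)
    then show ?thesis
      using that aut by (auto simp: AutoGroup_def BijGroup_def auto_def compose_def)
  qed
  have one: "\<phi> \<one>\<^bsub>T\<^esub> a = a" if "a \<in> carrier N" for a
  proof -
    have "inj_on (\<phi> \<one>\<^bsub>T\<^esub>) (carrier N)"
      using aut[of "\<one>\<^bsub>T\<^esub>"] by (auto simp: auto_def Bij_def bij_betw_def)
    moreover have "\<phi> \<one>\<^bsub>T\<^esub> (\<phi> \<one>\<^bsub>T\<^esub> a) = \<phi> \<one>\<^bsub>T\<^esub> a"
      using cmp[of "\<one>\<^bsub>T\<^esub>" "\<one>\<^bsub>T\<^esub>" a] that by simp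
    ultimately show ?thesis using cl that by (auto dest: inj_onD)
  qed
  have \<phi>1: "\<phi> t \<one>\<^bsub>N\<^esub> = \<one>\<^bsub>N\<^esub>" if "t \<in> carrier T" for t
    using mlt[OF that, of "\<one>\<^bsub>N\<^esub>" "\<one>\<^bsub>N\<^esub>"] cl[OF that, of "\<one>\<^bsub>N\<^esub>"]
    by (simp add: N.l_cancel_one)
  show ?thesis
  proof (rule groupI)
    fix x assume x: "x \<in> carrier (semidirect_product N T \<phi>)"
    then obtain a t where [simp]: "x = (a, t)" "a \<in> carrier N" "t \<in> carrier T"
      by (auto simp: semidirect_product_def)
    let ?y = "(\<phi> (inv\<^bsub>T\<^esub> t) (inv\<^bsub>N\<^esub> a), inv\<^bsub>T\<^esub> t)"
    have "?y \<otimes>\<^bsub>semidirect_product N T \<phi>\<^esub> x = \<one>\<^bsub>semidirect_product N T \<phi>\<^esub>"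
      by (simp add: semidirect_product_def mlt[symmetric] \<phi>1)
    then show "\<exists>y\<in>carrier (semidirect_product N T \<phi>).
        y \<otimes>\<^bsub>semidirect_product N T \<phi>\<^esub> x = \<one>\<^bsub>semidirect_product N T \<phi>\<^esub>"
      by (intro bexI[of _ ?y]) (auto simp: semidirect_product_def cl)
  qed (auto simp: semidirect_product_def cl one mlt cmp N.m_assoc T.m_assoc)
qed

context
  fixes C :: "('c, 'k) monoid_scheme" and T :: "('t, 'l) monoid_scheme"
  assumes C: "Group.group C" and T: "Group.group T"
begin

interpretation C: Group.group C by (rule C)
interpretation T: Group.group T by (rule T)

lemma group_wreath_base: "Group.group (wreath_base C T)"
  unfolding wreath_base_def by (rule sum_group) (rule C)

lemma carrier_wreath_base:
  "carrier (wreath_base C T) =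
     {f \<in> carrier T \<rightarrow>\<^sub>E carrier C. finite {s \<in> carrier T. f s \<noteq> \<one>\<^bsub>C\<^esub>}}"
  unfolding wreath_base_def by (rule carrier_sum_group) (rule C)

lemma translate_closed:
  assumes t: "t \<in> carrier T" and f: "f \<in> carrier (wreath_base C T)"
  shows "translate C T t f \<in> carrier (wreath_base C T)"
proof -
  have "{s \<in> carrier T. f (inv\<^bsub>T\<^esub> t \<otimes>\<^bsub>T\<^esub> s) \<noteq> \<one>\<^bsub>C\<^esub>}
      \<subseteq> (\<lambda>s. t \<otimes>\<^bsub>T\<^esub> s) ` {s \<in> carrier T. f s \<noteq> \<one>\<^bsub>C\<^esub>}"
  proof
    fix s assume s: "s \<in> {s \<in> carrier T. f (inv\<^bsub>T\<^esub> t \<otimes>\<^bsub>T\<^esub> s) \<noteq> \<one>\<^bsub>C\<^esub>}"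
    then have "s = t \<otimes>\<^bsub>T\<^esub> (inv\<^bsub>T\<^esub> t \<otimes>\<^bsub>T\<^esub> s)"
      using t by (simp add: T.m_assoc[symmetric])
    then show "s \<in> (\<lambda>s. t \<otimes>\<^bsub>T\<^esub> s) ` {s \<in> carrier T. f s \<noteq> \<one>\<^bsub>C\<^esub>}"
      using s t by (intro image_eqI[of _ _ "inv\<^bsub>T\<^esub> t \<otimes>\<^bsub>T\<^esub> s"]) auto
  qed
  then have "finite {s \<in> carrier T. f (inv\<^bsub>T\<^esub> t \<otimes>\<^bsub>T\<^esub> s) \<noteq> \<one>\<^bsub>C\<^esub>}"
    by (rule finite_subset) (use f in \<open>auto simp: carrier_wreath_base\<close>)
  moreover have "{s \<in> carrier T. translate C T t f s \<noteq> \<one>\<^bsub>C\<^esub>}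
      = {s \<in> carrier T. f (inv\<^bsub>T\<^esub> t \<otimes>\<^bsub>T\<^esub> s) \<noteq> \<one>\<^bsub>C\<^esub>}"
    using f by (auto simp: translate_def)
  moreover have "translate C T t f \<in> carrier T \<rightarrow>\<^sub>E carrier C"
    using f t by (auto simp: translate_def carrier_wreath_base PiE_iff)
  ultimately show ?thesis by (simp add: carrier_wreath_base)
qed

lemma translate_mult:
  assumes s: "s \<in> carrier T" and t: "t \<in> carrier T" and f: "f \<in> carrier (wreath_base C T)"
  shows "translate C T s (translate C T t f) = translate C T (s \<otimes>\<^bsub>T\<^esub> t) f"
proof
  fix x
  have "translate C T t f (inv\<^bsub>T\<^esub> s \<otimes>\<^bsub>T\<^esub> x)
      = f (inv\<^bsub>T\<^esub> (s \<otimes>\<^bsub>T\<^esub> t) \<otimes>\<^bsub>T\<^esub> x)" if "x \<in> carrier T"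
    using that s t f by (simp add: translate_def T.inv_mult_group T.m_assoc)
  then show "translate C T s (translate C T t f) x = translate C T (s \<otimes>\<^bsub>T\<^esub> t) f x"
    using translate_closed[OF t f] f by (simp add: translate_def[of C T s] translate_def[of C T "s \<otimes>\<^bsub>T\<^esub> t"])
qed

lemma translate_one:
  assumes "f \<in> carrier (wreath_base C T)"
  shows "translate C T \<one>\<^bsub>T\<^esub> f = f"
proof
  fix x
  have "f \<in> extensional (carrier T)"
    using assms by (simp add: carrier_wreath_base PiE_iff)
  then show "translate C T \<one>\<^bsub>T\<^esub> f x = f x"
    using assms by (simp add: translate_def extensional_def)
qed

lemma translate_auto:
  assumes t: "t \<in> carrier T"
  shows "translate C T t \<in> auto (wreath_base C T)"
proof -
  let ?N = "carrier (wreath_base C T)"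
  have "bij_betw (translate C T t) ?N ?N"
    by (rule bij_betw_byWitness[where f' = "translate C T (inv\<^bsub>T\<^esub> t)"])
       (use t in \<open>auto simp: translate_mult translate_one translate_closed\<close>)
  then have "translate C T t \<in> Bij ?N"
    by (auto simp: Bij_def translate_def)
  moreover have "translate C T t \<in> hom (wreath_base C T) (wreath_base C T)"
  proof (rule homI)
    fix f g assume fg: "f \<in> ?N" "g \<in> ?N"
    then have fgN: "f \<otimes>\<^bsub>wreath_base C T\<^esub> g \<in> ?N"
      by (intro monoid.m_closed group.is_monoid group_wreath_base)
    show "translate C T t (f \<otimes>\<^bsub>wreath_base C T\<^esub> g)
        = translate C T t f \<otimes>\<^bsub>wreath_base C T\<^esub> translate C T t g"
      using fg fgN t unfolding translate_def wreath_base_def by (auto simp: fun_eq_iff)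
  qed (simp add: translate_closed t)
  ultimately show ?thesis by (simp add: auto_def)
qed

lemma translate_hom: "translate C T \<in> hom T (AutoGroup (wreath_base C T))"
proof (rule homI)
  fix s t assume st: "s \<in> carrier T" "t \<in> carrier T"
  have "translate C T (s \<otimes>\<^bsub>T\<^esub> t)
      = compose (carrier (wreath_base C T)) (translate C T s) (translate C T t)"
  proof (rule extensionalityI)
    show "translate C T (s \<otimes>\<^bsub>T\<^esub> t) \<in> extensional (carrier (wreath_base C T))"
      by (simp add: translate_def)
  qed (simp_all add: compose_def translate_mult[OF st])
  then show "translate C T (s \<otimes>\<^bsub>T\<^esub> t)
      = translate C T s \<otimes>\<^bsub>AutoGroup (wreath_base C T)\<^esub> translate C T t"
    using st[THEN translate_auto] by (simp add: AutoGroup_def BijGroup_def auto_def)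
qed (simp add: AutoGroup_def translate_auto)

lemma group_wreath_product: "Group.group (wreath_product C T)"
  unfolding wreath_product_def
  by (rule group_semidirect_product[OF group_wreath_base T translate_hom])

end

end

theory Submission
  imports Defs
begin

text \<open>
  Fix a nontrivial lamp \<open>f\<close>, supported at one coordinate. It commutes with all its conjugates under the top
  group \<open>T\<close>. For piecewise linear maps this means that every \<open>t \<in> T\<close> which moves an orbital \<open>A\<close>
  of \<open>f\<close> (a component of its support) to an interval meeting \<open>A\<close> fixes the left end of \<open>A\<close> and
  commutes with \<open>f\<close> on \<open>A\<close>.

  Let \<open>F\<close> be the set of common fixed points of \<open>T\<close>. For \<open>1 \<noteq> w \<in> T\<close>, the commutator of \<open>f\<close> and
  \<open>w\<close> is a nontrivial element of the base group that is the identity to the right of every point of \<open>F\<close>,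
  so its support meets only finitely many components of the complement of \<open>F\<close>. Suppose such an element \<open>b\<close>
  is supported in a component \<open>(p, q)\<close>, and some \<open>1 \<noteq> w \<in> T\<close> is the identity to the left of \<open>q\<close>. A conjugate
  \<open>c\<close> of \<open>b\<close> by \<open>T\<close> has its support in \<open>(p, q)\<close> pushed so close to \<open>q\<close> that it commutes with \<open>w\<close> there.
  The commutator of \<open>c\<close> and \<open>w\<close> is again nontrivial, because a nontrivial top element commutes with no
  nontrivial base element, but its support meets fewer components. By descent there is a component for
  which taking the slope at \<open>q\<close> is injective on \<open>T\<close>.

  On this component \<open>f\<close> has an orbital whose left end \<open>l\<close> satisfies \<open>p < l\<close>. If the slopes of \<open>T\<close> at \<open>q\<close>
  were not discrete, an element of slope close to \<open>1\<close> would move a translate of this orbital near \<open>q\<close>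
  to an interval that meets it, without fixing its left end. So \<open>T\<close> is isomorphic to a nontrivial discrete subgroup
  of the positive reals.
\<close>

section \<open>Groups of homeomorphisms of the line supported in the unit interval\<close>

abbreviation finv :: "(real \<Rightarrow> real) \<Rightarrow> real \<Rightarrow> real" where
  "finv \<equiv> inv_into UNIV"

text \<open>Maps of the unit interval are extended to the whole line by the identity, so that the
  group operation is plain composition and the inverse is \<open>finv\<close>, without membership
  side conditions.\<close>

definition interval_homeos :: "(real \<Rightarrow> real) set" where
  "interval_homeos = {k. bij k \<and> strict_mono k \<and> (\<forall>x. x \<le> 0 \<or> 1 \<le> x \<longrightarrow> k x = x)}"

definition piecewise_affine :: "(real \<Rightarrow> real) \<Rightarrow> bool" where
  "piecewise_affine g \<longleftrightarrow> (\<exists>D. finite D \<and> (\<forall>u v. u < v \<and> {u<..<v} \<inter> D = {} \<longrightarrow> (\<exists>m c. \<forall>x\<in>{u..v}. g x = m * x + c)))"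

definition homeo_group :: "(real \<Rightarrow> real) set \<Rightarrow> bool" where
  "homeo_group K \<longleftrightarrow> K \<subseteq> interval_homeos \<and> id \<in> K \<and> (\<forall>g\<in>K. \<forall>h\<in>K. g \<circ> h \<in> K) \<and> (\<forall>g\<in>K. finv g \<in> K)"

lemma interval_homeos_simps:
  assumes "k \<in> interval_homeos"
  shows "k (finv k x) = x" "finv k (k x) = x" "k x < k y \<longleftrightarrow> x < y" "k x \<le> k y \<longleftrightarrow> x \<le> y" "k x = k y \<longleftrightarrow> x = y"
    "finv k x < finv k y \<longleftrightarrow> x < y" "finv k x \<le> finv k y \<longleftrightarrow> x \<le> y" "finv k x = y \<longleftrightarrow> x = k y"
    "finv k x < y \<longleftrightarrow> x < k y" "y < finv k x \<longleftrightarrow> k y < x" "finv k x \<le> y \<longleftrightarrow> x \<le> k y" "y \<le> finv k x \<longleftrightarrow> k y \<le> x"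
proof -
  have b: "bij k" and s: "strict_mono k" using assms by (auto simp: interval_homeos_def)
  have 1: "k (finv k x) = x" "finv k (k x) = x" for x
    using b by (simp_all add: bij_is_surj surj_f_inv_f bij_is_inj inv_f_f)
  have 2: "k x < k y \<longleftrightarrow> x < y" "k x \<le> k y \<longleftrightarrow> x \<le> y" for x y
    using s by (simp_all add: strict_mono_less strict_mono_less_eq)
  show "k (finv k x) = x" "finv k (k x) = x" "k x < k y \<longleftrightarrow> x < y" "k x \<le> k y \<longleftrightarrow> x \<le> y" by (fact 1 2)+
  show "k x = k y \<longleftrightarrow> x = y" "finv k x = y \<longleftrightarrow> x = k y" using 1 by metis+
  show "finv k x < finv k y \<longleftrightarrow> x < y" "finv k x \<le> finv k y \<longleftrightarrow> x \<le> y"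
    "finv k x < y \<longleftrightarrow> x < k y" "y < finv k x \<longleftrightarrow> k y < x" "finv k x \<le> y \<longleftrightarrow> x \<le> k y" "y \<le> finv k x \<longleftrightarrow> k y \<le> x"
    using 1 2 by metis+
qed

lemma interval_homeosI:
  assumes "\<And>x. g (h x) = x" "\<And>x. h (g x) = x" "strict_mono g" "\<And>x. x \<le> 0 \<or> 1 \<le> x \<Longrightarrow> g x = x"
  shows "g \<in> interval_homeos"
  using assms unfolding interval_homeos_def by (auto intro!: o_bij[of h g] simp: fun_eq_iff)

lemma interval_homeos_fixD: "k \<in> interval_homeos \<Longrightarrow> x \<le> 0 \<or> 1 \<le> x \<Longrightarrow> k x = x"
  unfolding interval_homeos_def by blast

lemma interval_homeos_id [simp]: "id \<in> interval_homeos"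
  by (auto simp: interval_homeos_def strict_mono_def)

lemma interval_homeos_comp [simp]:
  assumes "g \<in> interval_homeos" "h \<in> interval_homeos"
  shows "g \<circ> h \<in> interval_homeos"
  using assms by (auto simp: interval_homeos_def strict_mono_def bij_comp)

lemma interval_homeos_inv [simp]:
  assumes "g \<in> interval_homeos"
  shows "finv g \<in> interval_homeos"
proof (rule interval_homeosI[of _ g])
  show "finv g x = x" if "x \<le> 0 \<or> 1 \<le> x" for x
    using interval_homeos_fixD[OF assms that] by (simp add: interval_homeos_simps[OF assms])
qed (simp_all add: strict_mono_def interval_homeos_simps[OF assms])

section \<open>Affine germs of piecewise affine maps\<close>

lemma pl_right_germ:
  assumes "piecewise_affine g"
  obtains e m c where "e > 0" "\<And>x. z \<le> x \<Longrightarrow> x \<le> z + e \<Longrightarrow> g x = m * x + c"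
proof -
  obtain D where D: "finite D" "\<And>u v. u < v \<and> {u<..<v} \<inter> D = {} \<Longrightarrow> \<exists>m c. \<forall>x\<in>{u..v}. g x = m * x + c"
    using assms unfolding piecewise_affine_def by blast
  obtain e where e: "e > 0" "\<And>x. x \<in> D \<Longrightarrow> x \<noteq> z \<Longrightarrow> e \<le> dist z x"
    using finite_set_avoid[OF D(1), of z] by blast
  have "{z<..<z + e} \<inter> D = {}" using e(2) by (force simp: dist_real_def)
  with D(2)[of z "z + e"] e(1) obtain m c where "\<forall>x\<in>{z..z + e}. g x = m * x + c" by auto
  with e(1) show thesis by (intro that[of e m c]) auto
qed

lemma pl_left_germ:
  assumes "piecewise_affine g"
  obtains e m c where "e > 0" "\<And>x. z - e \<le> x \<Longrightarrow> x \<le> z \<Longrightarrow> g x = m * x + c"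
proof -
  obtain D where D: "finite D" "\<And>u v. u < v \<and> {u<..<v} \<inter> D = {} \<Longrightarrow> \<exists>m c. \<forall>x\<in>{u..v}. g x = m * x + c"
    using assms unfolding piecewise_affine_def by blast
  obtain e where e: "e > 0" "\<And>x. x \<in> D \<Longrightarrow> x \<noteq> z \<Longrightarrow> e \<le> dist z x"
    using finite_set_avoid[OF D(1), of z] by blast
  have "{z - e<..<z} \<inter> D = {}" using e(2) by (force simp: dist_real_def)
  with D(2)[of "z - e" z] e(1) obtain m c where "\<forall>x\<in>{z - e..z}. g x = m * x + c" by auto
  with e(1) show thesis by (intro that[of e m c]) auto
qed

lemma affine_two_fixed_points:
  fixes m c x y z :: real
  assumes "m * x + c = x" "m * y + c = y" "x \<noteq> y"
  shows "m * z + c = z"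
proof -
  have "(m - 1) * (x - y) = 0" using assms by (simp add: algebra_simps)
  then have "m = 1" using assms by simp
  then show ?thesis using assms by simp
qed

text \<open>The map is affine on some interval to the right of \<open>z\<close>, and an affine map
  with two fixed points is the identity. Finiteness of the set of breaks enters through the
  germ.\<close>

lemma pl_accumulating_fixed_points:
  assumes "piecewise_affine g" and acc: "\<And>e. e > 0 \<Longrightarrow> \<exists>x. z < x \<and> x < z + e \<and> g x = x"
  obtains e where "e > 0" "\<And>x. z \<le> x \<Longrightarrow> x \<le> z + e \<Longrightarrow> g x = x"
proof -
  obtain e m c where e: "e > 0" "\<And>x. z \<le> x \<Longrightarrow> x \<le> z + e \<Longrightarrow> g x = m * x + c"
    using pl_right_germ[OF assms(1)] by metis
  obtain x where x: "z < x" "x < z + e" "g x = x" using acc[OF e(1)] by auto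
  obtain y where y: "z < y" "y < x" "g y = y" using acc[of "x - z"] x by auto
  have "g u = u" if "z \<le> u" "u \<le> z + e" for u
    using affine_two_fixed_points[of m x c y u] x y e(2)[of x] e(2)[of y] e(2)[of u] that by auto
  then show thesis using e(1) that by blast
qed

section \<open>Orbits of a group of interval homeomorphisms\<close>

lemma homeo_groupD:
  assumes "homeo_group K"
  shows "g \<in> K \<Longrightarrow> g \<in> interval_homeos" "id \<in> K" "g \<in> K \<Longrightarrow> h \<in> K \<Longrightarrow> g \<circ> h \<in> K" "g \<in> K \<Longrightarrow> finv g \<in> K"
  using assms unfolding homeo_group_def by auto

text \<open>The orbit is invariant, so every \<open>k\<close> sends lower bounds of the orbit to
  lower bounds. Hence \<open>k z\<close> is at most \<open>z\<close>, and the inverse of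
  \<open>k\<close> gives the converse.\<close>

lemma orbit_Inf:
  fixes y :: real
  assumes K: "homeo_group K"
  defines "z \<equiv> Inf ((\<lambda>k. k y) ` K)"
  shows "k \<in> K \<Longrightarrow> k z = z" "k \<in> K \<Longrightarrow> z \<le> k y" "z < a \<Longrightarrow> \<exists>k\<in>K. k y < a"
    "(\<And>k. k \<in> K \<Longrightarrow> p \<le> k y) \<Longrightarrow> p \<le> z"
proof -
  note KD = homeo_groupD[OF K]
  \<comment> \<open>The point \<open>min 0 y\<close> is not positive, hence fixed by the group, and
    so bounds the orbit from below.\<close>
  have "min 0 y \<le> k y" if "k \<in> K" for k
  proof -
    have "k (min 0 y) \<le> k y" by (simp add: interval_homeos_simps[OF KD(1)[OF that]])
    then show ?thesis using interval_homeos_fixD[OF KD(1)[OF that], of "min 0 y"] by simp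
  qed
  then have bdd: "bdd_below ((\<lambda>k. k y) ` K)" by (intro bdd_belowI2)
  have ne: "(\<lambda>k. k y) ` K \<noteq> {}" using KD(2) by auto
  show lower: "z \<le> k y" if "k \<in> K" for k
    unfolding z_def by (rule cInf_lower[OF _ bdd]) (use that in auto)
  show great: "p \<le> z" if "\<And>k. k \<in> K \<Longrightarrow> p \<le> k y" for p
    unfolding z_def using that by (intro cInf_greatest[OF ne]) auto
  show "\<exists>k\<in>K. k y < a" if "z < a"
    using cInf_lessD[OF ne] that unfolding z_def by auto
  have le: "k z \<le> z" if "k \<in> K" for k
  proof (rule great)
    fix h assume h: "h \<in> K"
    have "z \<le> (finv k \<circ> h) y" by (rule lower) (use KD h that in blast)
    then show "k z \<le> h y" by (simp add: interval_homeos_simps[OF KD(1)[OF that]])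
  qed
  show "k z = z" if "k \<in> K"
    using le[OF that] le[OF KD(4)[OF that]] by (simp add: interval_homeos_simps[OF KD(1)[OF that]])
qed

lemma orbit_Sup:
  fixes y :: real
  assumes K: "homeo_group K"
  defines "z \<equiv> Sup ((\<lambda>k. k y) ` K)"
  shows "k \<in> K \<Longrightarrow> k z = z" "k \<in> K \<Longrightarrow> k y \<le> z" "a < z \<Longrightarrow> \<exists>k\<in>K. a < k y"
    "(\<And>k. k \<in> K \<Longrightarrow> k y \<le> p) \<Longrightarrow> z \<le> p"
proof -
  note KD = homeo_groupD[OF K]
  have "k y \<le> max 1 y" if "k \<in> K" for k
  proof -
    have "k y \<le> k (max 1 y)" by (simp add: interval_homeos_simps[OF KD(1)[OF that]])
    then show ?thesis using interval_homeos_fixD[OF KD(1)[OF that], of "max 1 y"] by simp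
  qed
  then have bdd: "bdd_above ((\<lambda>k. k y) ` K)" by (intro bdd_aboveI2)
  have ne: "(\<lambda>k. k y) ` K \<noteq> {}" using KD(2) by auto
  show upper: "k y \<le> z" if "k \<in> K" for k
    unfolding z_def by (rule cSup_upper[OF _ bdd]) (use that in auto)
  show least: "z \<le> p" if "\<And>k. k \<in> K \<Longrightarrow> k y \<le> p" for p
    unfolding z_def using that by (intro cSup_least[OF ne]) auto
  show "\<exists>k\<in>K. a < k y" if "a < z"
    using less_cSupD[OF ne] that unfolding z_def by auto
  have le: "z \<le> k z" if "k \<in> K" for k
  proof (rule least)
    fix h assume h: "h \<in> K"
    have "(finv k \<circ> h) y \<le> z" by (rule upper) (use KD h that in blast)
    then show "h y \<le> k z" by (simp add: interval_homeos_simps[OF KD(1)[OF that]])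
  qed
  show "k z = z" if "k \<in> K"
    using le[OF that] le[OF KD(4)[OF that]] by (simp add: interval_homeos_simps[OF KD(1)[OF that]])
qed

section \<open>Commuting maps on an orbital\<close>

lemma homeo_group_centralizer:
  assumes "g \<in> interval_homeos"
  shows "homeo_group {k \<in> interval_homeos. k \<circ> g = g \<circ> k}"
proof -
  have "finv k \<circ> g = g \<circ> finv k" if k: "k \<in> interval_homeos" "k \<circ> g = g \<circ> k" for k
  proof
    fix x
    have "k (g (finv k x)) = g (k (finv k x))" using k(2) by (metis comp_apply)
    then show "(finv k \<circ> g) x = (g \<circ> finv k) x" by (simp add: interval_homeos_simps[OF k(1)])
  qed
  then show ?thesis unfolding homeo_group_def by (auto simp: fun_eq_iff simp del: comp_apply intro: interval_homeos_comp interval_homeos_inv) (simp_all add: comp_def)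
qed

lemma homeo_group_stabilizer:
  assumes "homeo_group K"
  shows "homeo_group {k \<in> K. k l = l}"
proof -
  have "finv g l = l" if "g \<in> K" "g l = l" for g
    using that homeo_groupD(1)[OF assms] by (simp add: interval_homeos_simps)
  with assms show ?thesis unfolding homeo_group_def by auto
qed

text \<open>Suppose \<open>g\<close> moves \<open>l\<close>, and let \<open>z\<close> be the infimum
  of the orbit of \<open>l\<close> under the centralizer of \<open>f\<close>. The orbit consists of
  fixed points of \<open>f\<close> and does not contain \<open>z\<close>, so it accumulates at
  \<open>z\<close> and \<open>f\<close> is the identity just to the right of \<open>z\<close>. But
  right after each orbit point \<open>k l\<close> comes the interval from \<open>k l\<close> to
  \<open>k r\<close>, where \<open>f\<close> has no fixed point.\<close>

lemma commuting_fixes_orbital_end: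
  assumes f: "f \<in> interval_homeos" "piecewise_affine f" and g: "g \<in> interval_homeos" and comm: "g \<circ> f = f \<circ> g"
    and l: "f l = l" "l < r" and nofix: "\<And>x. l < x \<Longrightarrow> x < r \<Longrightarrow> f x \<noteq> x"
  shows "g l = l"
proof (rule ccontr)
  assume gl: "g l \<noteq> l"
  define K where "K = {k \<in> interval_homeos. k \<circ> f = f \<circ> k}"
  have K: "homeo_group K" unfolding K_def by (rule homeo_group_centralizer[OF f(1)])
  have gK: "g \<in> K" using g comm by (simp add: K_def)
  have KD: "k \<in> interval_homeos" "f (k x) = k (f x)" if "k \<in> K" for k x
    using that by (auto simp: K_def fun_eq_iff)
  define z where "z = Inf ((\<lambda>k. k l) ` K)"
  note z = orbit_Inf[OF K, where y = l, folded z_def]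
  have ne: "k l \<noteq> z" if "k \<in> K" for k
  proof
    assume "k l = z"
    then have "l = finv k z" by (simp add: interval_homeos_simps[OF KD(1)[OF that]] flip: \<open>k l = z\<close>)
    then have "l = z" using z(1)[OF homeo_groupD(4)[OF K that]] by simp
    then show False using z(1)[OF gK] gl by simp
  qed
  have "\<exists>x. z < x \<and> x < z + e \<and> f x = x" if e: "e > 0" for e
  proof -
    obtain k where k: "k \<in> K" "k l < z + e" using z(3)[of "z + e"] e by auto
    then show ?thesis using z(2)[OF k(1)] ne[OF k(1)] KD(2)[OF k(1), of l] l by (intro exI[of _ "k l"]) auto
  qed
  then obtain e where e: "e > 0" "\<And>x. z \<le> x \<Longrightarrow> x \<le> z + e \<Longrightarrow> f x = x"
    using pl_accumulating_fixed_points[OF f(2)] by blast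
  obtain k where k: "k \<in> K" "k l < z + e" using z(3)[of "z + e"] e(1) by auto
  note [simp] = interval_homeos_simps[OF KD(1)[OF k(1)]]
  \<comment> \<open>A point below both bounds is fixed by \<open>f\<close>, yet lies in the image
    under \<open>k\<close> of an interval without fixed points.\<close>
  have "k l < min (k r) (z + e)" using k l by simp
  then obtain x where x: "k l < x" "x < min (k r) (z + e)" using dense by blast
  have fx: "f x = x" using e(2)[of x] x z(2)[OF k(1)] by auto
  have "f (k (finv k x)) = k (f (finv k x))" by (rule KD(2)[OF k(1)])
  then have "f (finv k x) = finv k x" using fx
    by (metis interval_homeos_simps(2)[OF KD(1)[OF k(1)]] interval_homeos_simps(1)[OF KD(1)[OF k(1)]])
  moreover have "l < finv k x" "finv k x < r" using x by auto
  ultimately show False using nofix by blast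
qed

text \<open>The maps that commute with \<open>g\<close> and fix \<open>l\<close> form a group
  containing \<open>f\<close>. The infimum of the orbit of \<open>x\<close> is fixed by
  \<open>f\<close>, so it can only be \<open>l\<close>. Thus some \<open>k\<close> moves
  \<open>x\<close> to where \<open>g\<close> is the identity, and commuting with \<open>k\<close>
  carries this back to \<open>x\<close>.\<close>

lemma commuting_identity_near_orbital_end:
  assumes f: "f \<in> interval_homeos" and g: "g \<in> interval_homeos" and comm: "f \<circ> g = g \<circ> f"
    and l: "f l = l" and nofix: "\<And>x. l < x \<Longrightarrow> x < r \<Longrightarrow> f x \<noteq> x"
    and germ: "e > 0" "\<And>x. l < x \<Longrightarrow> x < l + e \<Longrightarrow> g x = x" and x: "l < x" "x < r"
  shows "g x = x"
proof -
  define K where "K = {k \<in> {k \<in> interval_homeos. k \<circ> g = g \<circ> k}. k l = l}"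
  have K: "homeo_group K" unfolding K_def
    by (intro homeo_group_stabilizer homeo_group_centralizer[OF g])
  have fK: "f \<in> K" using f comm l by (simp add: K_def)
  have KD: "k \<in> interval_homeos" "g (k x) = k (g x)" "k l = l" if "k \<in> K" for k x
    using that by (auto simp: K_def fun_eq_iff)
  define z where "z = Inf ((\<lambda>k. k x) ` K)"
  note z = orbit_Inf[OF K, where y = x, folded z_def]
  have "l \<le> z"
  proof (rule z(4))
    fix k assume "k \<in> K"
    then have "k l \<le> k x" using x by (simp add: interval_homeos_simps[OF KD(1)])
    then show "l \<le> k x" using KD(3)[OF \<open>k \<in> K\<close>] by simp
  qed
  moreover have "z \<le> x" using z(2)[OF homeo_groupD(2)[OF K]] by simp
  ultimately have "z = l" using nofix[of z] z(1)[OF fK] x by force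
  then obtain k where k: "k \<in> K" "k x < l + e" using z(3)[of "l + e"] germ by auto
  note [simp] = interval_homeos_simps[OF KD(1)[OF k(1)]]
  have "k l < k x" using x by simp
  then have "l < k x" using KD(3)[OF k(1)] by simp
  then have "g (k x) = k x" using germ k by blast
  then show ?thesis using KD(2)[OF k(1)] by simp
qed

text \<open>The conjugate \<open>h\<close> has no fixed point between \<open>finv t l\<close> and
  \<open>finv t r\<close>. By commutation \<open>h\<close> fixes \<open>l\<close> and
  \<open>f\<close> fixes \<open>finv t l\<close>; as the two intervals meet, these left ends
  coincide. Then \<open>f\<close> and \<open>t\<close> have commuting germs at \<open>l\<close>, so
  \<open>f\<close> and \<open>h\<close> agree near \<open>l\<close>, and the previous lemma applied
  to \<open>finv h\<close> composed with \<open>f\<close> extends this up to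
  \<open>r\<close>.\<close>

lemma conjugate_orbital_meets:
  assumes f: "f \<in> interval_homeos" "piecewise_affine f" and t: "t \<in> interval_homeos" "piecewise_affine t"
    and h: "h = finv t \<circ> f \<circ> t" "piecewise_affine h" and comm: "h \<circ> f = f \<circ> h"
    and l: "f l = l" and nofix: "\<And>x. l < x \<Longrightarrow> x < r \<Longrightarrow> f x \<noteq> x"
    and x: "l < x" "x < r" "l < t x" "t x < r"
  shows "t l = l" "\<And>y. l < y \<Longrightarrow> y < r \<Longrightarrow> f (t y) = t (f y)"
proof -
  have hh: "h \<in> interval_homeos" using f t h by simp
  note [simp] = interval_homeos_simps[OF f(1)] interval_homeos_simps[OF t(1)] interval_homeos_simps[OF hh]
  have hl: "h l = l"
    using commuting_fixes_orbital_end[OF f hh comm l _ nofix] x by simp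
  have hnofix: "h y \<noteq> y" if "finv t l < y" "y < finv t r" for y
    using nofix[of "t y"] that t by (simp add: h)
  have "f (finv t l) = finv t l"
    by (rule commuting_fixes_orbital_end[OF hh h(2) f(1) comm[symmetric], of _ "finv t r"])
       (use t l x hnofix in \<open>auto simp: h\<close>)
  moreover have "finv t l < x" using x by simp
  ultimately have "\<not> l < finv t l" using nofix[of "finv t l"] x by (meson less_trans)
  moreover have "t l < r" using x(1) x(4) less_trans[of "t l" "t x" r] by simp
  then have "\<not> finv t l < l" using hnofix[of l] hl x by auto
  ultimately show tl: "t l = l" by auto
  obtain e m c where e: "e > 0" "\<And>x. l \<le> x \<Longrightarrow> x \<le> l + e \<Longrightarrow> f x = m * x + c"
    using pl_right_germ[OF f(2)] by metis
  obtain e' m' c' where e': "e' > 0" "\<And>x. l \<le> x \<Longrightarrow> x \<le> l + e' \<Longrightarrow> t x = m' * x + c'"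
    using pl_right_germ[OF t(2)] by metis
  have "c = l - m * l" "c' = l - m' * l" using e(2)[of l] e'(2)[of l] e(1) e'(1) l tl by auto
  then have fe: "l \<le> x \<Longrightarrow> x \<le> l + e \<Longrightarrow> f x = l + m * (x - l)"
    and te: "l \<le> x \<Longrightarrow> x \<le> l + e' \<Longrightarrow> t x = l + m' * (x - l)" for x
    using e(2)[of x] e'(2)[of x] by (simp_all add: right_diff_distrib)
  \<comment> \<open>The last two entries keep \<open>t x\<close> in the affine range of
    \<open>f\<close> and \<open>f x\<close> in that of \<open>t\<close>, so both orders of
    composition can be computed.\<close>
  define d where "d = Min {e, e', finv t (l + e) - l, finv f (l + e') - l}"
  have d: "d > 0" using e(1) e'(1) f t tl l by (auto simp: d_def algebra_simps)
  have small: "x < l + e \<and> x < l + e' \<and> t x < l + e \<and> f x < l + e' \<and> l < t x \<and> l < f x"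
    if "l < x" "x < l + d" for x
  proof -
    have "d \<le> e" "d \<le> e'" "d \<le> finv t (l + e) - l" "d \<le> finv f (l + e') - l"
      by (simp_all add: d_def del: interval_homeos_simps)
    then have "x < l + e" "x < l + e'" "x < finv t (l + e)" "x < finv f (l + e')"
      using that(2) by linarith+
    moreover have "t l < t x" "f l < f x" using that f t by auto
    ultimately show ?thesis using f t tl l by auto
  qed
  \<comment> \<open>germs of affine maps with a common fixed point commute\<close>
  have germ: "f (t x) = t (f x)" if "l < x" "x < l + d" for x
  proof -
    have eqs: "f (t x) = l + m * (t x - l)" "t x = l + m' * (x - l)" "f x = l + m * (x - l)"
      "t (f x) = l + m' * (f x - l)"
      using fe[of "t x"] fe[of x] te[of "f x"] te[of x] small[OF that] that by auto
    show ?thesis unfolding eqs(1,4) unfolding eqs(2,3) by simp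
  qed
  define g where "g = finv h \<circ> f"
  have "f \<circ> g = g \<circ> f"
  proof
    fix x
    have "h (f (finv h (f x))) = f (h (finv h (f x)))" using comm by (metis comp_apply)
    then show "(f \<circ> g) x = (g \<circ> f) x"
      by (metis comp_apply g_def interval_homeos_simps(1,2)[OF hh])
  qed
  moreover have "g x = x" if "l < x" "x < l + d" for x
  proof -
    have "h x = f x" using germ[OF that] by (simp add: h(1))
    then show ?thesis by (simp add: g_def)
  qed
  ultimately have "g y = y" if "l < y" "y < r" for y
    using commuting_identity_near_orbital_end[OF f(1) _ _ l nofix d _ that, of g] f hh by (simp add: g_def)
  then show "f (t y) = t (f y)" if "l < y" "y < r" for y
  proof -
    have "f y = h y" using \<open>\<And>y. \<lbrakk>l < y; y < r\<rbrakk> \<Longrightarrow> g y = y\<close>[OF that] hh by (simp add: g_def)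
    then show ?thesis using t by (simp add: h)
  qed
qed

text \<open>The ends are the supremum of the fixed points up to \<open>x\<close> and the infimum of
  those from \<open>x\<close> on. They are fixed by monotonicity: both \<open>f\<close> and its
  inverse send \<open>Sup L\<close> to an upper bound of \<open>L\<close>, and dually for
  \<open>Inf R\<close>.\<close>

lemma orbital_exists:
  assumes f: "f \<in> interval_homeos" and x: "f x \<noteq> x"
  obtains l r where "l < x" "x < r" "f l = l" "f r = r" "\<And>y. l < y \<Longrightarrow> y < r \<Longrightarrow> f y \<noteq> y"
proof -
  have x01: "0 < x" "x < 1" using interval_homeos_fixD[OF f, of x] x by force+
  note [simp] = interval_homeos_simps[OF f]
  have f01: "f 0 = 0" "f 1 = 1" using interval_homeos_fixD[OF f] by auto
  define L where "L = {y. y \<le> x \<and> f y = y}"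
  define R where "R = {y. x \<le> y \<and> f y = y}"
  have L: "L \<noteq> {}" "bdd_above L" using x01 f01 by (auto simp: L_def intro!: exI[of _ 0])
  have R: "R \<noteq> {}" "bdd_below R" using x01 f01 by (auto simp: R_def intro!: exI[of _ 1])
  have up: "y \<le> Sup L" if "y \<in> L" for y using cSup_upper[OF that L(2)] .
  have lo: "Inf R \<le> y" if "y \<in> R" for y using cInf_lower[OF that R(2)] .
  have "Sup L \<le> f (Sup L)"
  proof (rule cSup_least[OF L(1)])
    fix y assume "y \<in> L" then show "y \<le> f (Sup L)" using up[of y] interval_homeos_simps(4)[OF f, of y "Sup L"] by (simp add: L_def)
  qed
  moreover have "Sup L \<le> finv f (Sup L)"
  proof (rule cSup_least[OF L(1)])
    fix y assume "y \<in> L" then show "y \<le> finv f (Sup L)" using up[of y] f by (simp add: L_def)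
  qed
  ultimately have fl: "f (Sup L) = Sup L" using f by simp
  have "f (Inf R) \<le> Inf R"
  proof (rule cInf_greatest[OF R(1)])
    fix y assume "y \<in> R" then show "f (Inf R) \<le> y" using lo[of y] interval_homeos_simps(4)[OF f, of "Inf R" y] by (simp add: R_def)
  qed
  moreover have "finv f (Inf R) \<le> Inf R"
  proof (rule cInf_greatest[OF R(1)])
    fix y assume "y \<in> R" then show "finv f (Inf R) \<le> y" using lo[of y] f by (simp add: R_def)
  qed
  ultimately have fr: "f (Inf R) = Inf R" using f by simp
  have "Sup L \<le> x" by (rule cSup_least[OF L(1)]) (auto simp: L_def)
  moreover have "x \<le> Inf R" by (rule cInf_greatest[OF R(1)]) (auto simp: R_def)
  moreover have "f y \<noteq> y" if "Sup L < y" "y < Inf R" for y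
    using up[of y] lo[of y] that by (cases "y \<le> x") (auto simp: L_def R_def)
  ultimately show thesis using that[of "Sup L" "Inf R"] fl fr x by force
qed

text \<open>By monotonicity, the iterates of a point that is moved up stay above it, and dually; so
  no positive power can return it.\<close>

lemma interval_homeos_funpow_eq_id:
  assumes k: "k \<in> interval_homeos" and n: "k ^^ n = id" "0 < n"
  shows "k = id"
proof
  fix x
  note [simp] = interval_homeos_simps[OF k]
  have up: "x < (k ^^ Suc n) x" if "x < k x" for n
  proof (induction n)
    case (Suc n)
    then have "k x < (k ^^ Suc (Suc n)) x" by simp
    then show ?case using that by linarith
  qed (use that in simp)
  have down: "(k ^^ Suc n) x < x" if "k x < x" for n
  proof (induction n)
    case (Suc n)
    then have "(k ^^ Suc (Suc n)) x < k x" by simp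
    then show ?case using that by linarith
  qed (use that in simp)
  obtain m where "n = Suc m" using n gr0_implies_Suc by blast
  then have "(k ^^ Suc m) x = x" using n by (metis id_apply)
  then show "k x = id x" using up[of m] down[of m] by (cases "k x" x rule: linorder_cases) (auto simp del: funpow.simps)
qed

section \<open>Commuting conjugates of a lamp\<close>

text \<open>An abstraction of a faithful action of the wreath product: \<open>T\<close> and
  \<open>B\<close> stand for the images of the top and the base group, and \<open>f\<close> for that
  of a function supported at one coordinate.\<close>

locale lamplighter =
  fixes T B :: "(real \<Rightarrow> real) set" and f :: "real \<Rightarrow> real"
  assumes T: "homeo_group T" and T_pl: "\<And>t. t \<in> T \<Longrightarrow> piecewise_affine t"
    and B: "homeo_group B" and B_pl: "\<And>b. b \<in> B \<Longrightarrow> piecewise_affine b"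
    and normal: "\<And>t b. t \<in> T \<Longrightarrow> b \<in> B \<Longrightarrow> t \<circ> b \<circ> finv t \<in> B"
    and free: "\<And>t b. t \<in> T \<Longrightarrow> b \<in> B \<Longrightarrow> t \<circ> b = b \<circ> t \<Longrightarrow> t \<noteq> id \<Longrightarrow> b = id"
    and lamp: "f \<in> B" "f \<noteq> id"
    and lamp_commute: "\<And>t. t \<in> T \<Longrightarrow> finv t \<circ> f \<circ> t \<circ> f = f \<circ> (finv t \<circ> f \<circ> t)"
    and T_nontrivial: "\<exists>w\<in>T. w \<noteq> id"
begin

lemmas TD = homeo_groupD[OF T]
lemmas BD = homeo_groupD[OF B]
lemmas T_simps = interval_homeos_simps[OF TD(1)]
lemmas B_simps = interval_homeos_simps[OF BD(1)]

lemma finv_finv: "k \<in> interval_homeos \<Longrightarrow> finv (finv k) = k"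
  by (rule inv_inv_eq) (simp add: interval_homeos_def)

lemma normal': "t \<in> T \<Longrightarrow> b \<in> B \<Longrightarrow> finv t \<circ> b \<circ> t \<in> B"
  using normal[of "finv t" b] TD(1,4) by (simp add: finv_finv)

section \<open>Common fixed points of \<open>T\<close> and the components of their
  complement\<close>

definition fixedT :: "real \<Rightarrow> bool" where "fixedT x \<longleftrightarrow> (\<forall>t\<in>T. t x = x)"
text \<open>The ends of the component of \<open>x\<close> in the complement of the common fixed points of \<open>T\<close>.\<close>
definition lower :: "real \<Rightarrow> real" where "lower x = Inf ((\<lambda>t. t x) ` T)"
definition upper :: "real \<Rightarrow> real" where "upper x = Sup ((\<lambda>t. t x) ` T)"

lemma lower_fixed: "fixedT (lower x)"
  using orbit_Inf(1)[OF T, where y = x] by (simp add: fixedT_def lower_def)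

lemma upper_fixed: "fixedT (upper x)"
  using orbit_Sup(1)[OF T, where y = x] by (simp add: fixedT_def upper_def)

lemma lower_le: "lower x \<le> x"
  using orbit_Inf(2)[OF T TD(2), where y = x] by (simp add: lower_def)

lemma upper_ge: "x \<le> upper x"
  using orbit_Sup(2)[OF T TD(2), where y = x] by (simp add: upper_def)

lemma fixed_le_iff: "fixedT p \<Longrightarrow> t \<in> T \<Longrightarrow> p \<le> t x \<longleftrightarrow> p \<le> x"
  using T_simps(4)[of t p x] by (metis fixedT_def)

lemma fixed_ge_iff: "fixedT p \<Longrightarrow> t \<in> T \<Longrightarrow> t x \<le> p \<longleftrightarrow> x \<le> p"
  using T_simps(4)[of t x p] by (metis fixedT_def)

lemma le_lower: "fixedT p \<Longrightarrow> p \<le> x \<Longrightarrow> p \<le> lower x"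
  unfolding lower_def by (rule orbit_Inf(4)[OF T]) (simp add: fixed_le_iff)

lemma upper_le: "fixedT p \<Longrightarrow> x \<le> p \<Longrightarrow> upper x \<le> p"
  unfolding upper_def by (rule orbit_Sup(4)[OF T]) (simp add: fixed_ge_iff)

lemma orbit_reaches: "a < upper x \<Longrightarrow> \<exists>t\<in>T. a < t x"
  unfolding upper_def by (rule orbit_Sup(3)[OF T])

lemma not_fixed_strict: "\<not> fixedT x \<Longrightarrow> lower x < x" "\<not> fixedT x \<Longrightarrow> x < upper x"
  using lower_le[of x] upper_ge[of x] lower_fixed[of x] upper_fixed[of x] by (auto simp: order_less_le)

text \<open>The value \<open>lower x\<close> is the largest common fixed point not above
  \<open>x\<close>, and a monotone map fixing all these points carries no point across one of
  them.\<close>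

lemma lower_invariant:
  assumes k: "k \<in> interval_homeos" and fixp: "\<And>p. fixedT p \<Longrightarrow> k p = p"
  shows "lower (k x) = lower x"
proof (rule antisym)
  have le: "p \<le> k x \<longleftrightarrow> p \<le> x" if "fixedT p" for p
    using interval_homeos_simps(4)[OF k, of p x] fixp[OF that] by simp
  show "lower (k x) \<le> lower x" using lower_le[of "k x"] le le_lower lower_fixed by blast
  show "lower x \<le> lower (k x)" using lower_le[of x] le le_lower lower_fixed by blast
qed

lemma component:
  assumes "lower x < y" "y < upper x"
  shows "lower y = lower x" "upper y = upper x" "\<not> fixedT y"
proof -
  have no: "p \<le> lower x \<or> upper x \<le> p" if "fixedT p" for p
    using le_lower[OF that, of x] upper_le[OF that, of x] by linarith
  show "lower y = lower x"
    using no[OF lower_fixed, of y] lower_le[of y] assms le_lower[OF lower_fixed, of x y] by linarith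
  show "upper y = upper x"
    using no[OF upper_fixed, of y] upper_ge[of y] assms upper_le[OF upper_fixed, of y x] by linarith
  show "\<not> fixedT y" using no assms by force
qed

text \<open>A common fixed point is its own \<open>lower\<close> and may also be the lower end of a
  component to its right; the two non-fixedness hypotheses exclude this.\<close>

lemma same_component:
  assumes "lower y = lower x" "\<not> fixedT x" "\<not> fixedT y"
  shows "lower x < y" "y < upper x" "upper y = upper x"
proof -
  show 1: "lower x < y" using not_fixed_strict(1)[OF assms(3)] assms(1) by simp
  show 2: "y < upper x"
  proof (rule ccontr)
    assume "\<not> y < upper x"
    then have "upper x \<le> lower x" using le_lower[OF upper_fixed, of x y] assms(1) by simp
    then show False using not_fixed_strict[OF assms(2)] by simp
  qed
  show "upper y = upper x" using component(2)[OF 1 2] .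
qed

section \<open>Right germs, supports and commutators of base elements\<close>

definition germ_id :: "real \<Rightarrow> (real \<Rightarrow> real) \<Rightarrow> bool" where
  "germ_id p b \<longleftrightarrow> (\<exists>e>0. \<forall>x. p \<le> x \<longrightarrow> x \<le> p + e \<longrightarrow> b x = x)"

lemma germ_idI: "p < a \<Longrightarrow> (\<And>x. p \<le> x \<Longrightarrow> x \<le> a \<Longrightarrow> b x = x) \<Longrightarrow> germ_id p b"
  unfolding germ_id_def by (intro exI[of _ "a - p"]) auto

lemma germ_idE:
  assumes "germ_id p b"
  obtains a where "p < a" "\<And>x. p \<le> x \<Longrightarrow> x \<le> a \<Longrightarrow> b x = x"
  using assms unfolding germ_id_def by (metis less_add_same_cancel1)

lemma germ_id_comp: "germ_id p b \<Longrightarrow> germ_id p c \<Longrightarrow> germ_id p (b \<circ> c)"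
proof (elim germ_idE)
  fix a a' assume "p < a" "\<And>x. p \<le> x \<Longrightarrow> x \<le> a \<Longrightarrow> b x = x" "p < a'" "\<And>x. p \<le> x \<Longrightarrow> x \<le> a' \<Longrightarrow> c x = x"
  then show ?thesis by (intro germ_idI[of p "min a a'"]) auto
qed

lemma germ_id_inv:
  assumes "b \<in> interval_homeos" "germ_id p b"
  shows "germ_id p (finv b)"
  using assms(2) by (elim germ_idE, intro germ_idI) (auto simp: interval_homeos_simps[OF assms(1)])

lemma germ_id_conj:
  assumes p: "fixedT p" and t: "t \<in> T" and b: "germ_id p b"
  shows "germ_id p (t \<circ> b \<circ> finv t)"
proof -
  note [simp] = T_simps[OF t]
  obtain a where a: "p < a" "\<And>x. p \<le> x \<Longrightarrow> x \<le> a \<Longrightarrow> b x = x" using germ_idE[OF b] by blast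
  have "t p = p" using p t by (simp add: fixedT_def)
  moreover have "t p < t a" using a by simp
  ultimately show ?thesis
    using a(2) by (intro germ_idI[of p "t a"]) auto
qed

definition locally_trivial :: "(real \<Rightarrow> real) \<Rightarrow> bool" where
  "locally_trivial b \<longleftrightarrow> b \<in> B \<and> (\<forall>p. fixedT p \<longrightarrow> germ_id p b)"

text \<open>A component is represented by its lower end.\<close>
definition support_components :: "(real \<Rightarrow> real) \<Rightarrow> real set" where
  "support_components b = lower ` {x. b x \<noteq> x}"

text \<open>In group notation \<open>w b^-1 w^-1 b\<close>, written as a quotient of two elements of
  \<open>B\<close>; it fixes exactly the points where \<open>b\<close> agrees with its conjugate by
  \<open>w\<close>.\<close>

definition commutator :: "(real \<Rightarrow> real) \<Rightarrow> (real \<Rightarrow> real) \<Rightarrow> real \<Rightarrow> real" where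
  "commutator b w = finv (w \<circ> b \<circ> finv w) \<circ> b"

lemma locally_trivial_fix: "locally_trivial b \<Longrightarrow> fixedT p \<Longrightarrow> b p = p"
  unfolding locally_trivial_def germ_id_def by (meson less_add_same_cancel1 order.refl less_imp_le)

lemma locally_trivial_conj: "locally_trivial b \<Longrightarrow> t \<in> T \<Longrightarrow> locally_trivial (t \<circ> b \<circ> finv t)"
  using normal germ_id_conj by (simp add: locally_trivial_def)

lemma commutator_in_B: "b \<in> B \<Longrightarrow> w \<in> T \<Longrightarrow> commutator b w \<in> B"
  unfolding commutator_def using BD(3,4) normal by simp

lemma commutator_fix: "b \<in> B \<Longrightarrow> w \<in> T \<Longrightarrow> commutator b w x = x \<longleftrightarrow> b x = w (b (finv w x))"
  unfolding commutator_def using B_simps(8)[OF normal] by simp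

lemma commutator_nontrivial:
  assumes "b \<in> B" "w \<in> T" "b \<noteq> id" "w \<noteq> id"
  shows "commutator b w \<noteq> id"
proof
  assume eq: "commutator b w = id"
  have "w \<circ> b = b \<circ> w"
  proof
    fix x
    have "commutator b w (w x) = w x" using eq by simp
    then show "(w \<circ> b) x = (b \<circ> w) x" using commutator_fix[OF assms(1,2), of "w x"] T_simps[OF assms(2)] by simp
  qed
  then show False using free assms by blast
qed

lemma germ_id_commutator:
  assumes "b \<in> B" "w \<in> T" "fixedT p" "germ_id p b"
  shows "germ_id p (commutator b w)"
  unfolding commutator_def using germ_id_conj[OF assms(3,2,4)] BD(1)[OF normal[OF assms(2,1)]] assms(4)
  by (simp add: germ_id_comp germ_id_inv del: fun.map_comp)

lemma locally_trivial_commutator: "locally_trivial b \<Longrightarrow> w \<in> T \<Longrightarrow> locally_trivial (commutator b w)"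
  using commutator_in_B germ_id_commutator by (simp add: locally_trivial_def)

lemma T_fixes_fixed: "t \<in> T \<Longrightarrow> fixedT p \<Longrightarrow> t p = p"
  by (simp add: fixedT_def)

lemma lower_T: "t \<in> T \<Longrightarrow> lower (t x) = lower x"
  by (intro lower_invariant TD(1) T_fixes_fixed)

lemma support_components_conj: 
  assumes t: "t \<in> T"
  shows "support_components (t \<circ> b \<circ> finv t) \<subseteq> support_components b"
proof
  fix p assume "p \<in> support_components (t \<circ> b \<circ> finv t)"
  then obtain x where x: "p = lower x" "t (b (finv t x)) \<noteq> x" by (auto simp: support_components_def)
  then have "b (finv t x) \<noteq> finv t x" using T_simps[OF t] by metis
  moreover have "p = lower (finv t x)" using x lower_T[OF TD(4)[OF t], of x] by simp
  ultimately show "p \<in> support_components b" unfolding support_components_def by blast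
qed

lemma support_components_commutator:
  assumes b: "b \<in> B" and w: "w \<in> T"
  shows "support_components (commutator b w) \<subseteq> support_components b"
proof
  fix p assume "p \<in> support_components (commutator b w)"
  then obtain x where x: "p = lower x" "commutator b w x \<noteq> x" by (auto simp: support_components_def)
  then have "b x \<noteq> w (b (finv w x))" using commutator_fix[OF b w] by simp
  then have "b x \<noteq> x \<or> (w \<circ> b \<circ> finv w) x \<noteq> x" by auto
  then show "p \<in> support_components b" using support_components_conj[OF w, of b] x by (auto simp: support_components_def)
qed

text \<open>Every component met by the support contains a break: \<open>b\<close> is the identity
  just to the right of the lower end \<open>p\<close>, so if it were affine from \<open>p\<close> to
  a moved point \<open>x\<close> it would have two fixed points and fix \<open>x\<close> as
  well.\<close>

lemma support_components_finite:
  assumes b: "locally_trivial b"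
  shows "finite (support_components b)"
proof -
  obtain D where D: "finite D" "\<And>u v. u < v \<and> {u<..<v} \<inter> D = {} \<Longrightarrow> \<exists>m c. \<forall>x\<in>{u..v}. b x = m * x + c"
    using B_pl[of b] b unfolding piecewise_affine_def locally_trivial_def by metis
  have "support_components b \<subseteq> lower ` D"
  proof
    fix p assume "p \<in> support_components b"
    then obtain x where x: "p = lower x" "b x \<noteq> x" by (auto simp: support_components_def)
    have p: "fixedT p" using lower_fixed x by simp
    have "\<not> fixedT x" using locally_trivial_fix[OF b] x by blast
    then have px: "p < x" using not_fixed_strict x by simp
    obtain a where a: "p < a" "\<And>x. p \<le> x \<Longrightarrow> x \<le> a \<Longrightarrow> b x = x"
      using germ_idE[of p b] b p unfolding locally_trivial_def by blast
    have "{p<..<x} \<inter> D \<noteq> {}"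
    proof
      assume "{p<..<x} \<inter> D = {}"
      then obtain m c where mc: "\<forall>y\<in>{p..x}. b y = m * y + c" using D(2)[of p x] px by auto
      define y where "y = min a x"
      have y: "p < y" "y \<le> x" "y \<le> a" using a px by (auto simp: y_def)
      have "m * p + c = p" "m * y + c = y"
        using mc[rule_format, of p] mc[rule_format, of y] a(2)[of p] a(2)[of y] y px by auto
      then have "m * x + c = x" using affine_two_fixed_points y by blast
      then show False using mc px x by auto
    qed
    then obtain d where d: "p < d" "d < x" "d \<in> D" by auto
    have "lower d = p" using component(1)[of x d] d x not_fixed_strict[OF \<open>\<not> fixedT x\<close>] by simp
    then show "p \<in> lower ` D" using d by blast
  qed
  then show ?thesis using D(1) finite_surj by blast
qed

text \<open>This is the descent step. On the component, the point \<open>t y\<close> separates the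
  supports of the conjugate \<open>c\<close> and of \<open>w\<close>, so their commutator is trivial
  there; \<open>free\<close> keeps it nontrivial elsewhere.\<close>

lemma reduce_support:
  assumes b: "locally_trivial b" "b \<noteq> id" and x: "b x \<noteq> x" and w: "w \<in> T" "w \<noteq> id"
    and a: "a < upper x" "\<And>z. a \<le> z \<Longrightarrow> z \<le> upper x \<Longrightarrow> w z = z"
  shows "\<exists>b'. locally_trivial b' \<and> b' \<noteq> id \<and> support_components b' \<subset> support_components b"
proof -
  define p q where "p = lower x" and "q = upper x"
  have nf: "\<not> fixedT x" using locally_trivial_fix[OF b(1)] x by blast
  have pq: "p < x" "x < q" using not_fixed_strict[OF nf] by (auto simp: p_def q_def)
  have pF: "fixedT p" and qF: "fixedT q" by (auto simp: p_def q_def lower_fixed upper_fixed)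
  have "germ_id p b" using b pF by (simp add: locally_trivial_def)
  then obtain a0 where a0: "p < a0" "\<And>x. p \<le> x \<Longrightarrow> x \<le> a0 \<Longrightarrow> b x = x" using germ_idE by blast
  \<comment> \<open>The minimum with \<open>x\<close> keeps \<open>y\<close> inside the
    component.\<close>
  define y where "y = min a0 x"
  have y: "p < y" "y < q" "\<And>x. p \<le> x \<Longrightarrow> x \<le> y \<Longrightarrow> b x = x" using a0 pq by (auto simp: y_def)
  have "upper y = q" using component(2)[of x y] y by (simp add: p_def q_def)
  then obtain t where t: "t \<in> T" "a < t y" using orbit_reaches[of a y] a by (auto simp: q_def)
  note [simp] = T_simps[OF t(1)] T_simps[OF w(1)]
  define c where "c = t \<circ> b \<circ> finv t"
  have c: "locally_trivial c" using locally_trivial_conj[OF b(1) t(1)] by (simp add: c_def)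
  then have cB: "c \<in> B" by (simp add: locally_trivial_def)
  note [simp] = B_simps[OF cB]
  have tp: "t p = p" "t q = q" "w p = p" "w q = q" using t w pF qF T_fixes_fixed by auto
  have cq: "c p = p" "c q = q" using locally_trivial_fix[OF c] pF qF by auto
  have cid: "c z = z" if "p \<le> z" "z \<le> t y" for z
  proof -
    have "p \<le> finv t z" "finv t z \<le> y" using that tp by auto
    then show ?thesis using y(3) by (simp add: c_def)
  qed
  have wty: "w (t y) = t y"
  proof (rule a(2))
    show "t y \<le> upper x" using fixed_ge_iff[OF qF t(1), of y] y by (simp add: q_def)
  qed (use t in simp)
  have commute: "c (w z) = w (c z)" if z: "p \<le> z" "z \<le> q" for z
  \<comment> \<open>Below \<open>t y\<close>, where \<open>c\<close> is the identity,
    \<open>w\<close> preserves the interval; above it the roles are exchanged.\<close>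
  proof (cases "z \<le> t y")
    case True
    have "w p \<le> w z" "w z \<le> w (t y)" using True z by simp_all
    then show ?thesis using cid[of z] cid[of "w z"] True z tp wty by simp
  next
    case False
    have "c (t y) \<le> c z" using False by simp
    moreover have "c z \<le> q" using B_simps(4)[OF cB, of z q] z unfolding cq by simp
    moreover have "c (t y) = t y" using cid[of "t y"] y tp fixed_le_iff[OF pF t(1), of y] by simp
    ultimately have "w (c z) = c z" using a(2)[of "c z"] t(2) unfolding q_def by linarith
    moreover have "w z = z" using a(2)[of z] False t z by (simp add: q_def)
    ultimately show ?thesis by simp
  qed
  let ?b = "commutator c w"
  have "c \<noteq> id"
  proof
    assume "c = id"
    then have "c (t z) = t z" for z by simp
    then have "b z = z" for z by (simp add: c_def)
    then show False using b by auto
  qed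
  then have "?b \<noteq> id" using commutator_nontrivial[OF cB w(1)] w by simp
  moreover have "support_components ?b \<subseteq> support_components b" using support_components_commutator[OF cB w(1)] support_components_conj[OF t(1), of b] by (simp add: c_def)
  moreover have "p \<in> support_components b" using x by (auto simp: support_components_def p_def)
  moreover have "p \<notin> support_components ?b"
  proof
    assume "p \<in> support_components ?b"
    then obtain z where z: "lower z = p" "?b z \<noteq> z" by (auto simp: support_components_def)
    have "\<not> fixedT z" using locally_trivial_fix[OF locally_trivial_commutator[OF c w(1)]] z by blast
    then have "p < z" "z < q" using same_component[of z x] nf z by (auto simp: p_def q_def)
    then have "p \<le> finv w z" "finv w z \<le> q" using tp by auto
    then have "w (c (finv w z)) = c z" using commute[of "finv w z"] by simp
    then show False using z commutator_fix[OF cB w(1)] by simp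
  qed
  ultimately show ?thesis using locally_trivial_commutator[OF c w(1)] by blast
qed

text \<open>Descent on the finite set of components met by the support: if some nontrivial
  \<open>w\<close> has trivial left germ at \<open>upper x\<close>, then
  \<open>reduce_support\<close> yields an element meeting fewer components.\<close>

lemma injective_germ:
  assumes "locally_trivial b" "b \<noteq> id"
  shows "\<exists>x. b x \<noteq> x \<and> (\<forall>w\<in>T. \<forall>a<upper x. (\<forall>z. a \<le> z \<longrightarrow> z \<le> upper x \<longrightarrow> w z = z) \<longrightarrow> w = id)"
  using support_components_finite[OF assms(1)] assms
proof (induction "support_components b" arbitrary: b rule: finite_psubset_induct)
  case psubset
  obtain x where x: "b x \<noteq> x" using psubset.prems by force
  show ?case
  proof (rule ccontr)
    assume neg: "\<not> ?thesis"
    then obtain w a where "w \<in> T" "a < upper x" "\<forall>z. a \<le> z \<longrightarrow> z \<le> upper x \<longrightarrow> w z = z" "w \<noteq> id"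
      using x by blast
    then obtain b' where b': "locally_trivial b'" "b' \<noteq> id" "support_components b' \<subset> support_components b"
      using reduce_support[OF psubset.prems x, of w a] by blast
    then obtain y where y: "b' y \<noteq> y" 
      "\<forall>w\<in>T. \<forall>a<upper y. (\<forall>z. a \<le> z \<longrightarrow> z \<le> upper y \<longrightarrow> w z = z) \<longrightarrow> w = id"
      using psubset.hyps(2)[of b'] by blast
    \<comment> \<open>The component found for \<open>b'\<close> is also met by the support of
      \<open>b\<close>, and the claim depends on the point only through
      \<open>upper\<close>.\<close>
    have "lower y \<in> support_components b" using b' y by (auto simp: support_components_def)
    then obtain v where v: "lower v = lower y" "b v \<noteq> v" by (auto simp: support_components_def)
    have "upper v = upper y"
      using same_component(3)[OF v(1)] locally_trivial_fix[OF b'(1)] locally_trivial_fix[OF psubset.prems(1)] v y by blast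
    then show False using neg v y by auto
  qed
qed

section \<open>The lamp near common fixed points\<close>

lemma lamp_orbital:
  assumes "t \<in> T" "f l = l" "\<And>x. l < x \<Longrightarrow> x < r \<Longrightarrow> f x \<noteq> x"
    "l < x" "x < r" "l < t x" "t x < r"
  shows "t l = l" "\<And>y. l < y \<Longrightarrow> y < r \<Longrightarrow> f (t y) = t (f y)"
proof -
  note orbital = conjugate_orbital_meets[OF BD(1)[OF lamp(1)] B_pl[OF lamp(1)] TD(1)[OF assms(1)] T_pl[OF assms(1)]
      refl B_pl[OF normal'[OF assms(1) lamp(1)]] lamp_commute[OF assms(1)], where l = l and r = r and x = x]
  show "t l = l" by (rule orbital(1)) (use assms in auto)
  show "f (t y) = t (f y)" if "l < y" "y < r" for y by (rule orbital(2)) (use assms that in auto)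
qed

text \<open>As \<open>t\<close> fixes \<open>p\<close>, points slightly to the right of
  \<open>p\<close> stay slightly to the right of \<open>p\<close>. The orbital of \<open>f\<close>
  around \<open>x\<close> starts at or before \<open>p\<close>, so it meets its image under
  \<open>t\<close>.\<close>

lemma commutes_near_fixed:
  assumes p: "fixedT p" and x: "p < x" "f x \<noteq> x" and nofix: "\<And>y. p < y \<Longrightarrow> y < x \<Longrightarrow> f y \<noteq> y" and t: "t \<in> T"
  shows "f (t x) = t (f x)"
proof -
  note [simp] = T_simps[OF t]
  obtain l r where lr: "l < x" "x < r" "f l = l" "\<And>y. l < y \<Longrightarrow> y < r \<Longrightarrow> f y \<noteq> y"
    using orbital_exists[OF BD(1)[OF lamp(1)] x(2)] by metis
  have lp: "l \<le> p" using nofix[of l] lr by force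
  have tp: "t p = p" using T_fixes_fixed p t by simp
  have "p < min x (finv t x)" using x tp by simp
  then obtain z where z: "p < z" "z < x" "z < finv t x" using dense[of p "min x (finv t x)"] by auto
  have "t p < t z" using z by simp
  then have "p < t z" "t z < x" using tp z by auto
  then show ?thesis
    by (intro lamp_orbital(2)[OF t, where l = l and r = r and x = z]) (use lr z lp in auto)
qed

text \<open>Either fixed points of \<open>f\<close> accumulate at \<open>p\<close> from the right
  and \<open>f\<close> is the identity there, or \<open>f\<close> has none just to the right of
  \<open>p\<close> and commutes with \<open>w\<close> there.\<close>

lemma locally_trivial_commutator_lamp:
  assumes w: "w \<in> T"
  shows "locally_trivial (commutator f w)"
  unfolding locally_trivial_def
proof (intro conjI allI impI)
  show "commutator f w \<in> B" using commutator_in_B lamp w by simp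
  fix p assume p: "fixedT p"
  note [simp] = T_simps[OF w]
  show "germ_id p (commutator f w)"
  proof (cases "\<forall>e>0. \<exists>x. p < x \<and> x < p + e \<and> f x = x")
    case True
    then obtain e where "e > 0" "\<And>x. p \<le> x \<Longrightarrow> x \<le> p + e \<Longrightarrow> f x = x"
      using pl_accumulating_fixed_points[OF B_pl[OF lamp(1)], of p] by metis
    then have "germ_id p f" by (auto simp: germ_id_def)
    then show ?thesis using germ_id_commutator[OF lamp(1) w p] by simp
  next
    case False
    then obtain e where e: "e > 0" "\<And>x. p < x \<Longrightarrow> x < p + e \<Longrightarrow> f x \<noteq> x" by blast
    have id: "commutator f w x = x" if "p < x" "x < p + e" for x
    proof -
      have "f (finv w x) = finv w (f x)"
        using e that by (intro commutes_near_fixed[OF p _ _ _ TD(4)[OF w]]) auto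
      then show ?thesis using commutator_fix[OF lamp(1) w] by simp
    qed
    \<comment> \<open>The accumulation lemma is used again to include the point \<open>p\<close>
      itself.\<close>
    have "\<exists>x. p < x \<and> x < p + d \<and> commutator f w x = x" if "d > 0" for d
      using dense[of p "min (p + d) (p + e)"] that e(1) id by fastforce
    then obtain d where "d > 0" "\<And>x. p \<le> x \<Longrightarrow> x \<le> p + d \<Longrightarrow> commutator f w x = x"
      using pl_accumulating_fixed_points[OF B_pl[OF commutator_in_B[OF lamp(1) w]], of p] by metis
    then show ?thesis by (auto simp: germ_id_def)
  qed
qed

text \<open>This provides an orbital of \<open>f\<close> whose left end lies strictly inside the
  component. Without such a \<open>y\<close>, \<open>f\<close> would commute with \<open>w\<close>
  or its inverse at \<open>z\<close> by \<open>commutes_near_fixed\<close>. The witness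
  \<open>z\<close> is \<open>x\<close> if \<open>f\<close> moves \<open>x\<close>, and
  \<open>finv w x\<close> otherwise.\<close>

lemma commutator_lamp_support:
  assumes w: "w \<in> T" and x: "commutator f w x \<noteq> x"
  shows "\<exists>y z. lower z = lower x \<and> f z \<noteq> z \<and> lower x < y \<and> y < z \<and> f y = y"
proof -
  note [simp] = T_simps[OF w]
  have ne: "f x \<noteq> w (f (finv w x))" using commutator_fix[OF lamp(1) w] x by simp
  have nf: "\<not> fixedT x" using locally_trivial_fix[OF locally_trivial_commutator_lamp[OF w]] x by blast
  then have px: "lower x < x" using not_fixed_strict by simp
  show ?thesis
  proof (cases "f x = x")
    case False
    have "f (finv w x) = finv w (f x)" if "\<And>y. lower x < y \<Longrightarrow> y < x \<Longrightarrow> f y \<noteq> y"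
      by (rule commutes_near_fixed[OF lower_fixed px False that TD(4)[OF w]])
    moreover have "f (finv w x) \<noteq> finv w (f x)" using ne by auto
    ultimately show ?thesis using False by blast
  next
    case True
    let ?z = "finv w x"
    have lz: "lower ?z = lower x" using lower_T[OF TD(4)[OF w]] .
    have pz: "lower x < ?z" using px T_fixes_fixed[OF w lower_fixed] by simp
    have fz: "f ?z \<noteq> ?z" using True ne by auto
    have "f (w ?z) = w (f ?z)" if "\<And>y. lower x < y \<Longrightarrow> y < ?z \<Longrightarrow> f y \<noteq> y"
      by (rule commutes_near_fixed[OF lower_fixed pz fz that w])
    moreover have "f (w ?z) \<noteq> w (f ?z)" using ne by simp
    ultimately show ?thesis using lz fz by blast
  qed
qed

end

section \<open>Slopes at a common fixed point\<close>

text \<open>The infimum \<open>s\<close> of the elements above 1 is attained, since otherwise two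
  such elements would have a ratio strictly between 1 and the gap. Dividing by the largest power of
  \<open>s\<close> not above \<open>x\<close> leaves 1.\<close>

lemma discrete_multiplicative_subgroup_cyclic:
  fixes S :: "real set"
  assumes one: "1 \<in> S" and pos: "\<And>x. x \<in> S \<Longrightarrow> 0 < x" and div: "\<And>x y. x \<in> S \<Longrightarrow> y \<in> S \<Longrightarrow> x / y \<in> S"
    and gap: "1 < \<rho>" "\<And>x. x \<in> S \<Longrightarrow> 1 < x \<Longrightarrow> \<rho> \<le> x"
  shows "\<exists>s\<in>S. \<forall>x\<in>S. 1 \<le> x \<longrightarrow> (\<exists>n::nat. x = s ^ n)"
proof (cases "\<exists>x\<in>S. 1 < x")
  case False
  \<comment> \<open>With no element above 1, the generator is 1 itself.\<close>
  then have "x = 1 ^ 0" if "x \<in> S" "1 \<le> x" for x using that by force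
  with one show ?thesis by metis
next
  case True
  define A where "A = {x \<in> S. 1 < x}"
  define s where "s = Inf A"
  have ne: "A \<noteq> {}" and bdd: "bdd_below A" using True by (auto simp: A_def intro!: bdd_belowI[of _ 1])
  have s: "\<rho> \<le> s" unfolding s_def using ne gap by (intro cInf_greatest) (auto simp: A_def)
  have low: "s \<le> x" if "x \<in> A" for x unfolding s_def using bdd that by (rule cInf_lower[rotated])
  have "s < s * \<rho>" using s gap by simp
  then obtain v where v: "v \<in> A" "v < s * \<rho>" using cInf_lessD[OF ne] unfolding s_def by blast
  have sA: "s \<in> A"
  proof (rule ccontr)
    assume "s \<notin> A"
    then have "s < v" using low[OF v(1)] v(1) by (cases "s = v") auto
    then obtain v' where v': "v' \<in> A" "v' < v" using cInf_lessD[OF ne] unfolding s_def by blast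
    have "1 < v'" using v' by (simp add: A_def)
    have "v / v' \<in> S" "1 < v / v'" using v v' div \<open>1 < v'\<close> by (auto simp: A_def)
    then have "\<rho> \<le> v / v'" using gap by blast
    then have "\<rho> * v' \<le> v" using \<open>1 < v'\<close> by (simp add: field_simps)
    moreover have "\<rho> * s \<le> \<rho> * v'" using low[OF v'(1)] gap by simp
    ultimately show False using v by (simp add: mult.commute)
  qed
  then have s1: "1 < s" "s \<in> S" by (auto simp: A_def)
  have pow: "x / s ^ k \<in> S" if "x \<in> S" for x and k :: nat
  proof (induction k)
    case (Suc k)
    have eq: "x / s ^ Suc k = x / s ^ k / s" by (simp add: mult.commute)
    show ?case unfolding eq by (rule div[OF Suc s1(2)])
  qed (use that in simp)
  have "\<exists>n::nat. x = s ^ n" if x: "x \<in> S" "1 \<le> x" for x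
  proof -
    define n where "n = (LEAST n. x < s ^ n)"
    have ex: "\<exists>n. x < s ^ n" using real_arch_pow[OF s1(1)] .
    have n: "x < s ^ n" unfolding n_def using ex by (rule LeastI_ex)
    then have "n \<noteq> 0" using x by (intro notI) simp
    then obtain k where k: "n = Suc k" using not0_implies_Suc by blast
    have "\<not> x < s ^ k" using not_less_Least[of k "\<lambda>n. x < s ^ n"] k by (simp add: n_def)
    then have ge: "1 \<le> x / s ^ k" using s1 by simp
    have "x / s ^ k < s" using n k s1 by (simp add: field_simps)
    then have "x / s ^ k \<notin> A" using low by force
    then have "x / s ^ k = 1" using ge pow[OF x(1), of k] by (auto simp: A_def)
    then have "x = s ^ k" using s1 by (simp add: field_simps)
    then show ?thesis by blast
  qed
  then show ?thesis using s1 by blast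
qed

text \<open>Here \<open>y\<close> is the distance to \<open>q\<close> from the left, so composition
  near \<open>q\<close> becomes multiplication of slopes; \<open>y = 0\<close> forces
  \<open>g q = q\<close>.\<close>

definition left_slope :: "real \<Rightarrow> (real \<Rightarrow> real) \<Rightarrow> real \<Rightarrow> bool" where
  "left_slope q g m \<longleftrightarrow> 0 < m \<and> (\<exists>e>0. \<forall>y. 0 \<le> y \<longrightarrow> y \<le> e \<longrightarrow> g (q - y) = q - m * y)"

lemma left_slope_exists:
  assumes g: "g \<in> interval_homeos" "piecewise_affine g" "g q = q"
  shows "\<exists>m. left_slope q g m"
proof -
  obtain e m c where e: "e > 0" "\<And>x. q - e \<le> x \<Longrightarrow> x \<le> q \<Longrightarrow> g x = m * x + c"
    using pl_left_germ[OF g(2)] by metis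
  have c: "c = q - m * q" using e(2)[of q] e(1) g(3) by simp
  have eq: "g (q - y) = q - m * y" if "0 \<le> y" "y \<le> e" for y
    using e(2)[of "q - y"] that by (simp add: c algebra_simps)
  have "g (q - e) < g q" using e(1) by (simp add: interval_homeos_simps[OF g(1)])
  then have "0 < m * e" using eq[of e] e(1) g(3) by simp
  then have "0 < m" using e(1) by (simp add: zero_less_mult_iff)
  then show ?thesis using e(1) eq unfolding left_slope_def by blast
qed

lemma left_slope_unique:
  assumes "left_slope q g m" "left_slope q g m'"
  shows "m = m'"
proof -
  obtain e e' where e: "e > 0" "\<And>y. 0 \<le> y \<Longrightarrow> y \<le> e \<Longrightarrow> g (q - y) = q - m * y"
    "e' > 0" "\<And>y. 0 \<le> y \<Longrightarrow> y \<le> e' \<Longrightarrow> g (q - y) = q - m' * y"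
    using assms unfolding left_slope_def by metis
  have "q - m * min e e' = q - m' * min e e'" using e(1,3) e(2)[of "min e e'"] e(4)[of "min e e'"] by linarith
  moreover have "min e e' > 0" using e by simp
  ultimately show ?thesis by simp
qed

lemma left_slope_comp:
  assumes "left_slope q g m" "left_slope q h n"
  shows "left_slope q (g \<circ> h) (m * n)"
proof -
  obtain e e' where e: "e > 0" "\<And>y. 0 \<le> y \<Longrightarrow> y \<le> e \<Longrightarrow> g (q - y) = q - m * y"
    "e' > 0" "\<And>y. 0 \<le> y \<Longrightarrow> y \<le> e' \<Longrightarrow> h (q - y) = q - n * y" and mn: "m > 0" "n > 0"
    using assms unfolding left_slope_def by metis
  define d where "d = min e' (e / n)"
  have "(g \<circ> h) (q - y) = q - (m * n) * y" if y: "0 \<le> y" "y \<le> d" for y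
  proof -
    have "y \<le> e'" "y * n \<le> e" using y mn by (auto simp: d_def pos_le_divide_eq)
    then show ?thesis using e(4)[of y] e(2)[of "n * y"] y mn by (simp add: mult.commute)
  qed
  moreover have "d > 0" using e mn by (simp add: d_def)
  ultimately show ?thesis using mn unfolding left_slope_def by auto
qed

context lamplighter
begin

lemma funpow_in_T: "t \<in> T \<Longrightarrow> t ^^ n \<in> T"
  by (induction n) (use TD(2,3) in auto)

text \<open>The slope at \<open>q\<close> embeds \<open>T\<close> into the positive reals. Its gap
  is the ratio of the distances to \<open>q\<close> of two points of a translated orbital, a
  quantity unchanged by linear contraction towards \<open>q\<close>.\<close>

lemma T_cyclic_of_injective_germ:
  assumes p: "lower x < l" and lr: "f l = l" "l < x" "x < r" "\<And>y. l < y \<Longrightarrow> y < r \<Longrightarrow> f y \<noteq> y"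
    and x: "\<not> fixedT x" and inj: "\<And>w a. w \<in> T \<Longrightarrow> a < upper x \<Longrightarrow> (\<And>z. a \<le> z \<Longrightarrow> z \<le> upper x \<Longrightarrow> w z = z) \<Longrightarrow> w = id"
  shows "\<exists>v\<in>T. \<forall>t\<in>T. \<exists>n::nat. t = v ^^ n \<or> finv t = v ^^ n"
proof -
  define q where "q = upper x"
  have xq: "x < q" using not_fixed_strict[OF x] by (simp add: q_def)
  have qF: "fixedT q" by (simp add: q_def upper_fixed)
  have "upper l = q" using component(2)[of x l] p lr xq by (simp add: q_def)
  have "\<exists>m. left_slope q t m" if "t \<in> T" for t
    using left_slope_exists TD(1) T_pl T_fixes_fixed qF that by simp
  then obtain sl where sl: "\<And>t. t \<in> T \<Longrightarrow> left_slope q t (sl t)" by metis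
  have slope_eq: "sl t = m" if "t \<in> T" "left_slope q t m" for t m
    using left_slope_unique[OF sl that(2)] that by simp
  have sl_pos: "0 < sl t" if "t \<in> T" for t using sl[OF that] by (simp add: left_slope_def)
  have sl_comp: "sl (s \<circ> t) = sl s * sl t" if "s \<in> T" "t \<in> T" for s t
    using slope_eq TD(3) left_slope_comp sl that by simp
  have sl_id: "sl id = 1" by (rule slope_eq[OF TD(2)]) (auto simp: left_slope_def intro: exI[of _ 1])
  have sl_inv: "sl (finv t) = 1 / sl t" if "t \<in> T" for t
  proof -
    have "finv t \<circ> t = id" using T_simps[OF that] by auto
    then show ?thesis using sl_comp[OF TD(4)[OF that] that] sl_id sl_pos[OF that] by (simp add: field_simps)
  qed
  have sl_pow: "sl (t ^^ n) = sl t ^ n" if "t \<in> T" for t n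
    by (induction n) (simp_all add: sl_id[unfolded id_def] sl_id sl_comp funpow_in_T that del: comp_apply)
  have sl_inj: "t = id" if t: "t \<in> T" "sl t = 1" for t
  proof -
    obtain e where e: "e > 0" "\<And>y. 0 \<le> y \<Longrightarrow> y \<le> e \<Longrightarrow> t (q - y) = q - y"
      using sl[OF t(1)] t(2) unfolding left_slope_def by auto
    show ?thesis
    proof (rule inj[OF t(1), of "q - e"])
      show "t z = z" if "q - e \<le> z" "z \<le> upper x" for z
        using e(2)[of "q - z"] that by (simp add: q_def)
    qed (use e in \<open>simp add: q_def\<close>)
  qed
  have sl_inj2: "s = t" if "s \<in> T" "t \<in> T" "sl s = sl t" for s t
  proof -
    have "s \<circ> finv t = id"
      using sl_inj[OF TD(3)[OF that(1) TD(4)[OF that(2)]]] sl_comp[OF that(1) TD(4)[OF that(2)]]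
        sl_inv[OF that(2)] sl_pos[OF that(2)] that(3) by simp
    then have "s (finv t (t y)) = t y" for y by (metis comp_apply id_apply)
    then show ?thesis using T_simps[OF that(2)] by auto
  qed
  obtain w where w: "w \<in> T" "w \<noteq> id" using T_nontrivial by blast
  have "sl w \<noteq> 1" using sl_inj w by blast
  then obtain t0 where t0: "t0 \<in> T" "sl t0 < 1"
    using w sl_inv[OF w(1)] TD(4)[OF w(1)] sl_pos[OF w(1)] by (cases "sl w < 1") auto
  define m where "m = sl t0"
  have m: "0 < m" "m < 1" using t0 sl_pos by (auto simp: m_def)
  obtain e where e: "e > 0" "\<And>y. 0 \<le> y \<Longrightarrow> y \<le> e \<Longrightarrow> t0 (q - y) = q - m * y"
    using sl[OF t0(1)] unfolding left_slope_def m_def by auto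
  \<comment> \<open>The second conjunct keeps the iterates in the range where \<open>t0\<close> is
    linear.\<close>
  have contract: "(t0 ^^ n) (q - y) = q - m ^ n * y \<and> m ^ n * y \<le> e" if "0 \<le> y" "y \<le> e" for n y
  proof (induction n)
    case (Suc n)
    have nn: "0 \<le> m ^ n * y" using m that by simp
    then have "m * (m ^ n * y) \<le> m ^ n * y" using m by (simp add: mult_left_le_one_le)
    then show ?case using Suc e(2)[OF nn] by (simp add: mult.assoc)
  qed (use that in simp)
  \<comment> \<open>Some translate of \<open>l\<close>, and with it that of \<open>x\<close>, lies
    in the linear range of \<open>t0\<close>.\<close>
  obtain t1 where t1: "t1 \<in> T" "q - e < t1 l" using orbit_reaches[of "q - e" l] e(1) \<open>upper l = q\<close> by auto
  define L X where "L = q - t1 l" and "X = q - t1 x"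
  have "t1 l < t1 x" "t1 x < t1 q" using T_simps(3)[OF t1(1)] lr xq by auto
  then have LX: "0 < X" "X < L" "L < e" using t1 T_fixes_fixed[OF t1(1) qF] by (auto simp: L_def X_def)
  have gap: "L / X \<le> sl u" if u: "u \<in> T" "1 < sl u" for u
  proof (rule ccontr)
    assume "\<not> L / X \<le> sl u"
    then have less: "sl u * X < L" using LX by (simp add: field_simps)
    obtain d where d: "d > 0" "\<And>y. 0 \<le> y \<Longrightarrow> y \<le> d \<Longrightarrow> u (q - y) = q - sl u * y"
      using sl[OF u(1)] unfolding left_slope_def by auto
    \<comment> \<open>\<open>t0 ^^ n\<close> keeps the ratio of \<open>L\<close> and \<open>X\<close> and moves both points to where \<open>u\<close> is linear\<close>
    obtain n where n: "m ^ n < d / L" using real_arch_pow_inv[of "d / L" m] m d LX by auto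
    then have nd: "m ^ n * L < d" using LX by (simp add: pos_less_divide_eq)
    have mn: "m ^ n > 0" using m by simp
    define s where "s = t0 ^^ n \<circ> t1"
    have s: "s \<in> T" using TD(3) funpow_in_T t0 t1 by (simp add: s_def)
    have sl': "s l = q - m ^ n * L" "s x = q - m ^ n * X"
      using contract[of L n] contract[of X n] LX by (simp_all add: s_def L_def X_def)
    have mX: "m ^ n * X < m ^ n * L" using mn LX by simp
    then have "m ^ n * X \<le> d" using nd by linarith
    then have us: "u (s l) = q - sl u * (m ^ n * L)" "u (s x) = q - sl u * (m ^ n * X)"
      using d(2)[of "m ^ n * L"] d(2)[of "m ^ n * X"] mn LX nd by (simp_all add: sl')
    have "m ^ n * (sl u * X) < m ^ n * L" using less mn by simp
    then have 1: "s l < u (s x)" unfolding us(2) sl'(1) by (simp add: mult_ac)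
    have "1 * (m ^ n * X) < sl u * (m ^ n * X)" using u mn LX by (intro mult_strict_right_mono) auto
    then have 2: "u (s x) < s x" unfolding us(2) unfolding sl'(2) by simp
    \<comment> \<open>Conjugating by \<open>s\<close> returns to the original orbital, where both
      \<open>x\<close> and \<open>t x\<close> lie, so \<open>lamp_orbital\<close> makes
      \<open>t\<close> fix \<open>l\<close>.\<close>
    define t where "t = finv s \<circ> u \<circ> s"
    have t: "t \<in> T" using TD(3,4) s u by (simp add: t_def)
    have "l < t x" "t x < x" using 1 2 T_simps[OF s] by (simp_all add: t_def)
    then have "t l = l" by (intro lamp_orbital(1)[OF t lr(1,4), of r x]) (use lr in auto)
    then have "u (s l) = s l" using T_simps[OF s] by (simp add: t_def)
    then have "sl u * (m ^ n * L) = 1 * (m ^ n * L)" unfolding us(1) unfolding sl'(1) by simp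
    moreover have "m ^ n * L > 0" using mn LX by simp
    ultimately have "sl u = 1" by (metis mult_right_cancel less_irrefl)
    then show False using u by simp
  qed
  have "\<exists>\<sigma>\<in>sl ` T. \<forall>y\<in>sl ` T. 1 \<le> y \<longrightarrow> (\<exists>n::nat. y = \<sigma> ^ n)"
  proof (rule discrete_multiplicative_subgroup_cyclic[where \<rho> = "L / X"])
    show "1 \<in> sl ` T" using sl_id TD(2) by force
    show "1 < L / X" using LX by simp
    show "a / b \<in> sl ` T" if "a \<in> sl ` T" "b \<in> sl ` T" for a b
    proof -
      obtain s t where st: "s \<in> T" "t \<in> T" "a = sl s" "b = sl t" using \<open>a \<in> sl ` T\<close> \<open>b \<in> sl ` T\<close> by blast
      have "a / b = sl (s \<circ> finv t)" using sl_comp[OF st(1) TD(4)[OF st(2)]] sl_inv[OF st(2)] st by simp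
      then show ?thesis using TD(3,4) st by blast
    qed
  qed (use sl_pos gap in auto)
  then obtain v where v: "v \<in> T" "\<And>t. t \<in> T \<Longrightarrow> 1 \<le> sl t \<Longrightarrow> \<exists>n::nat. sl t = sl v ^ n" by blast
  have pow: "\<exists>n::nat. t = v ^^ n" if "t \<in> T" "1 \<le> sl t" for t
    using v(2)[OF that] sl_inj2[OF that(1) funpow_in_T[OF v(1)]] sl_pow[OF v(1)] by auto
  have "\<exists>n::nat. t = v ^^ n \<or> finv t = v ^^ n" if t: "t \<in> T" for t
  proof (cases "1 \<le> sl t")
    case True
    then show ?thesis using pow t by blast
  next
    case False
    then have "1 \<le> sl (finv t)" using sl_inv[OF t] sl_pos[OF t] by simp
    then show ?thesis using pow[OF TD(4)[OF t]] by blast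
  qed
  then show ?thesis using v(1) by blast
qed

lemma T_cyclic: "\<exists>v\<in>T. \<forall>t\<in>T. \<exists>n::nat. t = v ^^ n \<or> finv t = v ^^ n"
proof -
  obtain w where w: "w \<in> T" "w \<noteq> id" using T_nontrivial by blast
  obtain x where x: "commutator f w x \<noteq> x"
    "\<And>t a. t \<in> T \<Longrightarrow> a < upper x \<Longrightarrow> (\<And>z. a \<le> z \<Longrightarrow> z \<le> upper x \<Longrightarrow> t z = z) \<Longrightarrow> t = id"
    using injective_germ[OF locally_trivial_commutator_lamp[OF w(1)] commutator_nontrivial[OF lamp(1) w(1) lamp(2) w(2)]] by blast
  obtain y z where yz: "lower z = lower x" "f z \<noteq> z" "lower x < y" "y < z" "f y = y"
    using commutator_lamp_support[OF w(1) x(1)] by blast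
  have nx: "\<not> fixedT x" using locally_trivial_fix[OF locally_trivial_commutator_lamp[OF w(1)]] x(1) by blast
  have nz: "\<not> fixedT z"
  proof
    assume "fixedT z"
    then have "z \<le> lower z" by (intro le_lower) auto
    then show False using yz by simp
  qed
  have uz: "upper z = upper x" using same_component(3)[OF yz(1) nx nz] .
  obtain l r where lr: "l < z" "z < r" "f l = l" "\<And>y. l < y \<Longrightarrow> y < r \<Longrightarrow> f y \<noteq> y"
    using orbital_exists[OF BD(1)[OF lamp(1)] yz(2)] by metis
  \<comment> \<open>An orbital contains no fixed point, so the fixed point \<open>y\<close> below
    \<open>z\<close> lies at or before its left end.\<close>
  have "y \<le> l" using lr(4)[of y] lr(2) yz by force
  then have "lower z < l" using yz by simp
  then show ?thesis
    using T_cyclic_of_injective_germ[OF _ lr(3,1,2,4) nz] x(2) uz by auto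
qed

end

section \<open>Transfer to the wreath product\<close>

definition extend_id :: "(real \<Rightarrow> real) \<Rightarrow> real \<Rightarrow> real" where
  "extend_id g x = (if x \<in> {0..1} then g x else x)"

lemma PL\<^sub>o_set_ends:
  assumes g: "g \<in> PL\<^sub>o_set"
  shows "g 0 = 0" "g 1 = 1" "x \<in> {0..1} \<Longrightarrow> g x \<in> {0..1}"
proof -
  note G = PL\<^sub>o_setD[OF g]
  show im: "g x \<in> {0..1}" if "x \<in> {0..1}" for x using G(2) that by (auto simp: bij_betw_def)
  have "0 \<in> g ` {0..1}" "1 \<in> g ` {0..1}" unfolding bij_betw_imp_surj_on[OF G(2)] by simp_all
  then obtain x y where xy: "x \<in> {0..1}" "g x = 0" "y \<in> {0..1}" "g y = 1" by (metis imageE)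
  have "g 0 \<le> g x" "g y \<le> g 1" using strict_mono_on_01_iff(2)[OF G(3), of 0 x] strict_mono_on_01_iff(2)[OF G(3), of y 1] xy by auto
  then show "g 0 = 0" "g 1 = 1" using xy im[of 0] im[of 1] by auto
qed

lemma extend_id_interval_homeos:
  assumes g: "g \<in> PL\<^sub>o_set"
  shows "extend_id g \<in> interval_homeos"
proof -
  note G = PL\<^sub>o_setD[OF g] and ends = PL\<^sub>o_set_ends[OF g]
  have mono: "strict_mono (extend_id g)"
  proof (rule strict_monoI)
    fix x y :: real assume xy: "x < y"
    consider "x < 0" | "1 < y" | "x \<in> {0..1}" "y \<in> {0..1}" using xy by fastforce
    then show "extend_id g x < extend_id g y"
    proof cases
      case 3
      then show ?thesis using strict_mono_on_01_iff(1)[OF G(3) 3] xy by (simp add: extend_id_def)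
    next
      case 1
      then show ?thesis using ends(3)[of y] xy by (auto simp: extend_id_def)
    next
      case 2
      then show ?thesis using ends(3)[of x] xy by (auto simp: extend_id_def)
    qed
  qed
  have "\<exists>x. extend_id g x = y" for y
  proof (cases "y \<in> {0..1}")
    case True
    then obtain x where "x \<in> {0..1}" "g x = y" using G(2) by (metis bij_betw_def imageE)
    then show ?thesis by (intro exI[of _ x]) (simp add: extend_id_def)
  qed (auto simp: extend_id_def)
  then have "surj (extend_id g)" by (metis surj_def)
  then have "bij (extend_id g)" using mono by (simp add: bij_def strict_mono_imp_inj_on)
  moreover have "extend_id g x = x" if "x \<le> 0 \<or> 1 \<le> x" for x
    using that ends(1,2) by (cases "x = 0 \<or> x = 1") (auto simp: extend_id_def)
  ultimately show ?thesis using mono by (simp add: interval_homeos_def)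
qed

lemma extend_id_pl:
  assumes g: "g \<in> PL\<^sub>o_set"
  shows "piecewise_affine (extend_id g)"
proof -
  obtain D where D: "finite D" "\<And>u v. 0 \<le> u \<and> u < v \<and> v \<le> 1 \<and> {u<..<v} \<inter> D = {} \<Longrightarrow>
           (\<exists>m c. \<forall>x\<in>{u..v}. g x = m * x + c)"
    using PL\<^sub>o_setD(5)[OF g] unfolding piecewise_linear_on_def by blast
  have out: "extend_id g x = x" if "x \<le> 0 \<or> 1 \<le> x" for x
    using interval_homeos_fixD[OF extend_id_interval_homeos[OF g] that] .
  have "\<exists>m c. \<forall>x\<in>{u..v}. extend_id g x = m * x + c"
    if uv: "u < v" "{u<..<v} \<inter> (D \<union> {0, 1}) = {}" for u v
  proof -
    have "\<not> (u < 0 \<and> 0 < v)" "\<not> (u < 1 \<and> 1 < v)" using uv(2) by auto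
    then consider "v \<le> 0" | "1 \<le> u" | "0 \<le> u" "v \<le> 1" using uv(1) by linarith
    then show ?thesis
    proof cases
      case 3
      then obtain m c where "\<forall>x\<in>{u..v}. g x = m * x + c" using D(2)[of u v] uv by auto
      then show ?thesis using 3 by (intro exI[of _ m] exI[of _ c]) (auto simp: extend_id_def)
    qed (intro exI[of _ 1] exI[of _ 0]; auto simp: out)+
  qed
  then show ?thesis unfolding piecewise_affine_def using D(1) by (intro exI[of _ "D \<union> {0, 1}"]) auto
qed

lemma extend_id_compose:
  assumes "h \<in> PL\<^sub>o_set"
  shows "extend_id (compose {0..1} g h) = extend_id g \<circ> extend_id h"
proof
  show "extend_id (compose {0..1} g h) x = (extend_id g \<circ> extend_id h) x" for x
    using PL\<^sub>o_set_ends(3)[OF assms, of x] unfolding extend_id_def by (auto simp: compose_def)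
qed

lemma extend_id_inj: "inj_on extend_id PL\<^sub>o_set"
proof (rule inj_onI)
  fix g h assume gh: "g \<in> PL\<^sub>o_set" "h \<in> PL\<^sub>o_set" "extend_id g = extend_id h"
  show "g = h"
  proof (rule extensionalityI[of _ "{0..1}"])
    show "g \<in> extensional {0..1}" "h \<in> extensional {0..1}"
      using gh(1,2)[THEN PL\<^sub>o_setD(1)] by (auto simp: Bij_def)
    show "g x = h x" if "x \<in> {0..1}" for x
      using fun_cong[OF gh(3), of x] that by (simp add: extend_id_def)
  qed
qed

text \<open>A faithful action on the line, used for the wreath product and, by restriction, for its
  top and base groups.\<close>

locale homeo_action = group G for G :: "('g, 'k) monoid_scheme" (structure) +
  fixes E :: "'g \<Rightarrow> real \<Rightarrow> real"
  assumes E_homeo: "a \<in> carrier G \<Longrightarrow> E a \<in> interval_homeos"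
    and E_mult: "a \<in> carrier G \<Longrightarrow> b \<in> carrier G \<Longrightarrow> E (a \<otimes> b) = E a \<circ> E b"
    and E_inj: "inj_on E (carrier G)"
begin

lemma E_one: "E \<one> = id"
proof
  fix x
  have "E \<one> (E \<one> x) = E \<one> x" using E_mult[of \<one> \<one>] by (metis comp_apply l_one one_closed)
  then show "E \<one> x = id x" using interval_homeos_simps(5)[OF E_homeo[OF one_closed]]
    by (metis id_apply)
qed

lemma E_inv:
  assumes "a \<in> carrier G"
  shows "E (inv a) = finv (E a)"
proof
  fix x
  have "E a (E (inv a) x) = x" using E_mult[of a "inv a"] assms E_one by (metis comp_apply id_apply inv_closed r_inv)
  then show "E (inv a) x = finv (E a) x" using interval_homeos_simps(2)[OF E_homeo[OF assms]] by metis
qed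

lemma E_eq_iff: "a \<in> carrier G \<Longrightarrow> b \<in> carrier G \<Longrightarrow> E a = E b \<longleftrightarrow> a = b"
  using E_inj by (auto dest: inj_onD)

lemma E_eq_id_iff: "a \<in> carrier G \<Longrightarrow> E a = id \<longleftrightarrow> a = \<one>"
  using E_eq_iff[of a \<one>] E_one by simp

lemma E_pow: 
  assumes "a \<in> carrier G"
  shows "E (a [^] (n::nat)) = E a ^^ n"
proof (induction n)
  case (Suc n)
  have "E (a [^] Suc n) = E (a [^] n) \<circ> E a" using assms by (simp add: E_mult)
  then show ?case by (simp only: Suc funpow_Suc_right)
qed (simp add: E_one)

lemma homeo_group_image: "homeo_group (E ` carrier G)"
  unfolding homeo_group_def
proof (intro conjI ballI)
  show "id \<in> E ` carrier G" using E_one one_closed by (metis imageI)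
  show "g \<circ> h \<in> E ` carrier G" if "g \<in> E ` carrier G" "h \<in> E ` carrier G" for g h
    using that by (auto simp flip: E_mult)
  show "finv g \<in> E ` carrier G" if "g \<in> E ` carrier G" for g
    using that by (auto simp flip: E_inv)
qed (use E_homeo in auto)

lemma torsion_free:
  assumes "a \<in> carrier G" "a [^] (n::nat) = \<one>" "0 < n"
  shows "a = \<one>"
proof -
  have "E a ^^ n = id" unfolding E_pow[OF assms(1), symmetric] assms(2) by (rule E_one)
  then have "E a = id" by (rule interval_homeos_funpow_eq_id[OF E_homeo[OF assms(1)] _ assms(3)])
  then show ?thesis unfolding E_eq_id_iff[OF assms(1)] .
qed

text \<open>The generation hypothesis has the form delivered by iterates of functions, which have
  only natural exponents. Torsion-freeness makes integer powers of \<open>v\<close>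
  distinct.\<close>

lemma iso_integer_group:
  assumes v: "v \<in> carrier G" and gen: "\<And>t. t \<in> carrier G \<Longrightarrow> \<exists>n::nat. t = v [^] n \<or> inv t = v [^] n"
    and nontrivial: "\<not> trivial_group G"
  shows "G \<cong> integer_group"
proof -
  have "v \<noteq> \<one>"
  proof
    assume "v = \<one>"
    then have "carrier G = {\<one>}" using gen by auto
    then show False using nontrivial is_group by (simp add: trivial_group_def)
  qed
  have int_pow_ne: "v [^] k \<noteq> \<one>" if "k \<noteq> 0" for k :: int
  proof
    assume "v [^] k = \<one>"
    then have "v [^] (nat \<bar>k\<bar>) = \<one>"
      using v by (cases "k < 0") (simp_all only: int_pow_def2 abs_if if_True if_False inv_eq_1_iff nat_pow_closed)
    then have "v = \<one>" by (rule torsion_free[OF v]) (use that in simp)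
    then show False using \<open>v \<noteq> \<one>\<close> by contradiction
  qed
  let ?h = "\<lambda>k::int. v [^] k"
  have "?h \<in> hom integer_group G" by (rule hom_integer_group_pow[OF v])
  moreover have "inj ?h"
  proof (rule injI)
    fix i j :: int assume "v [^] i = v [^] j"
    then have "v [^] (i - j) = \<one>" using v by (simp add: int_pow_diff)
    then show "i = j" using int_pow_ne[of "i - j"] by auto
  qed
  moreover have "range ?h = carrier G"
  proof
    show "carrier G \<subseteq> range ?h"
    proof
      fix t assume t: "t \<in> carrier G"
      obtain n :: nat where "t = v [^] n \<or> inv t = v [^] n" using gen[OF t] by blast
      then have "t = v [^] int n \<or> t = v [^] (- int n)"
      proof
        assume "inv t = v [^] n"
        then have "t = inv (v [^] n)" using inv_inv[OF t] by simp
        then show ?thesis using v by (simp add: int_pow_neg int_pow_int)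
      qed (simp add: int_pow_int)
      then show "t \<in> range ?h" by blast
    qed
  qed (use v in auto)
  ultimately have "?h \<in> iso integer_group G" by (simp add: iso_def bij_betw_def)
  then show ?thesis using group.iso_sym[OF group_integer_group] by (auto simp: is_iso_def)
qed

end

lemma homeo_action_hom:
  assumes "homeo_action G E" "group K" "j \<in> hom K G" "inj_on j (carrier K)"
  shows "homeo_action K (E \<circ> j)"
proof -
  interpret homeo_action G E by fact
  interpret K: group K by fact
  have j: "j x \<in> carrier G" if "x \<in> carrier K" for x using assms(3) that by (auto simp: hom_def)
  show ?thesis
  proof unfold_locales
    show "(E \<circ> j) (a \<otimes>\<^bsub>K\<^esub> b) = (E \<circ> j) a \<circ> (E \<circ> j) b" if "a \<in> carrier K" "b \<in> carrier K" for a b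
      using E_mult[OF j j] hom_mult[OF assms(3)] that by simp
    show "inj_on (E \<circ> j) (carrier K)"
      by (rule comp_inj_on[OF assms(4) inj_on_subset[OF E_inj]]) (use j in auto)
  qed (use E_homeo j in auto)
qed

lemma homeo_action_PL\<^sub>o:
  assumes H: "subgroup H PL\<^sub>o" and G: "group G" and \<phi>: "\<phi> \<in> iso G (PL\<^sub>o\<lparr>carrier := H\<rparr>)"
  shows "homeo_action G (extend_id \<circ> \<phi>)" "a \<in> carrier G \<Longrightarrow> piecewise_affine ((extend_id \<circ> \<phi>) a)"
proof -
  interpret group G by fact
  have "H \<subseteq> PL\<^sub>o_set" using subgroup.subset[OF H] by (simp add: PL\<^sub>o_def)
  then have im: "\<phi> a \<in> PL\<^sub>o_set" if "a \<in> carrier G" for a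
    using \<phi> that by (auto simp: iso_def hom_def)
  then show "a \<in> carrier G \<Longrightarrow> piecewise_affine ((extend_id \<circ> \<phi>) a)" by (simp add: extend_id_pl)
  show "homeo_action G (extend_id \<circ> \<phi>)"
  proof unfold_locales
    show "(extend_id \<circ> \<phi>) (a \<otimes>\<^bsub>G\<^esub> b) = (extend_id \<circ> \<phi>) a \<circ> (extend_id \<circ> \<phi>) b"
      if ab: "a \<in> carrier G" "b \<in> carrier G" for a b
    proof -
      have "\<phi> (a \<otimes>\<^bsub>G\<^esub> b) = \<phi> a \<otimes>\<^bsub>PL\<^sub>o\<lparr>carrier := H\<rparr>\<^esub> \<phi> b" using \<phi> ab by (simp add: iso_def hom_def)
      also have "\<dots> = compose {0..1} (\<phi> a) (\<phi> b)"
        using im[OF ab(1), THEN PL\<^sub>o_setD(1)] im[OF ab(2), THEN PL\<^sub>o_setD(1)] by (simp add: PL\<^sub>o_def BijGroup_def)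
      finally show ?thesis using extend_id_compose[OF im[OF ab(2)]] by simp
    qed
    show "inj_on (extend_id \<circ> \<phi>) (carrier G)"
    proof (rule comp_inj_on)
      show "inj_on \<phi> (carrier G)" using \<phi> by (simp add: iso_def bij_betw_def)
      show "inj_on extend_id (\<phi> ` carrier G)" using im by (auto intro: inj_on_subset[OF extend_id_inj])
    qed
  qed (use im extend_id_interval_homeos in auto)
qed

lemma translate_apply:
  "b \<in> carrier (wreath_base C T) \<Longrightarrow> s \<in> carrier T \<Longrightarrow> translate C T t b s = b (inv\<^bsub>T\<^esub> t \<otimes>\<^bsub>T\<^esub> s)"
  by (simp add: translate_def)

lemma wreath_base_eqI:
  assumes "group C" "group T" "a \<in> carrier (wreath_base C T)" "b \<in> carrier (wreath_base C T)" "\<And>s. s \<in> carrier T \<Longrightarrow> a s = b s"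
  shows "a = b"
  using assms carrier_wreath_base[OF assms(1,2)] by (intro extensionalityI[of a "carrier T"]) (auto simp: PiE_iff)

theorem theorem1p2:
  fixes H :: "(real \<Rightarrow> real) set"
    and C :: "('c, 'k) monoid_scheme" and T :: "('t, 'l) monoid_scheme"
  assumes "subgroup H PL\<^sub>o"
    and "Group.group C" and "\<not> trivial_group C"
    and "Group.group T" and "\<not> trivial_group T"
    and "PL\<^sub>o\<lparr>carrier := H\<rparr> \<cong> wreath_product C T"
  shows "T \<cong> integer_group"
proof -
  interpret C: group C by fact
  interpret T: group T by fact
  define N where "N = wreath_base C T"
  interpret N: group N unfolding N_def by (rule group_wreath_base[OF assms(2,4)])
  define W where "W = wreath_product C T"
  interpret W: group W unfolding W_def by (rule group_wreath_product[OF assms(2,4)])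
  have W_simps: "carrier W = carrier N \<times> carrier T"
    "(a, s) \<otimes>\<^bsub>W\<^esub> (b, t) = (a \<otimes>\<^bsub>N\<^esub> translate C T s b, s \<otimes>\<^bsub>T\<^esub> t)" for a b s t
    by (simp_all add: W_def wreath_product_def semidirect_product_def N_def)
  note [simp] = translate_closed[OF assms(2,4), folded N_def] translate_one[OF assms(2,4), folded N_def]
  have translate_unit [simp]: "translate C T t \<one>\<^bsub>N\<^esub> = \<one>\<^bsub>N\<^esub>" if "t \<in> carrier T" for t
  proof (rule wreath_base_eqI[OF assms(2,4), folded N_def])
    show "translate C T t \<one>\<^bsub>N\<^esub> s = \<one>\<^bsub>N\<^esub> s" if "s \<in> carrier T" for s
      using that \<open>t \<in> carrier T\<close> N.one_closed by (simp add: N_def translate_apply) (simp add: wreath_base_def)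
  qed (use that in simp_all)
  have "group (PL\<^sub>o\<lparr>carrier := H\<rparr>)" by (rule subgroup.subgroup_is_group[OF assms(1) group_PL\<^sub>o])
  then obtain \<phi> where \<phi>: "\<phi> \<in> iso W (PL\<^sub>o\<lparr>carrier := H\<rparr>)"
    using group.iso_sym assms(6) unfolding W_def is_iso_def by blast
  define E where "E = extend_id \<circ> \<phi>"
  interpret W: homeo_action W E unfolding E_def by (rule homeo_action_PL\<^sub>o(1)[OF assms(1) W.group_axioms \<phi>])
  have pl_E: "piecewise_affine (E a)" if "a \<in> carrier W" for a
    using homeo_action_PL\<^sub>o(2)[OF assms(1) W.group_axioms \<phi> that] by (simp add: E_def)
  define top base where "top = E \<circ> (\<lambda>t. (\<one>\<^bsub>N\<^esub>, t))" and "base = E \<circ> (\<lambda>b. (b, \<one>\<^bsub>T\<^esub>))"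
  interpret top: homeo_action T top unfolding top_def
    by (rule homeo_action_hom[OF W.homeo_action_axioms]) (auto simp: hom_def W_simps inj_on_def)
  interpret base: homeo_action N base unfolding base_def
    by (rule homeo_action_hom[OF W.homeo_action_axioms]) (auto simp: hom_def W_simps inj_on_def)
  \<comment> \<open>Both sides are the image of the pair of \<open>translate C T t b\<close> and
    \<open>t\<close>.\<close>
  have act: "top t \<circ> base b = base (translate C T t b) \<circ> top t" if "t \<in> carrier T" "b \<in> carrier N" for t b
    using that W.E_mult[of "(\<one>\<^bsub>N\<^esub>, t)" "(b, \<one>\<^bsub>T\<^esub>)"] W.E_mult[of "(translate C T t b, \<one>\<^bsub>T\<^esub>)" "(\<one>\<^bsub>N\<^esub>, t)"]
    by (simp add: top_def base_def W_simps)
  have conj: "top t \<circ> base b \<circ> inv_into UNIV (top t) = base (translate C T t b)" if "t \<in> carrier T" "b \<in> carrier N" for t b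
    unfolding act[OF that] using interval_homeos_simps(1)[OF top.E_homeo[OF that(1)]] by auto
  obtain c where c: "c \<in> carrier C" "c \<noteq> \<one>\<^bsub>C\<^esub>"
    using assms(3) C.group_axioms C.one_closed unfolding trivial_group_def by blast
  obtain w where w: "w \<in> carrier T" "w \<noteq> \<one>\<^bsub>T\<^esub>"
    using assms(5) T.group_axioms T.one_closed unfolding trivial_group_def by blast
  define lamp where "lamp = (\<lambda>s\<in>carrier T. if s = \<one>\<^bsub>T\<^esub> then c else \<one>\<^bsub>C\<^esub>)"
  have "finite {s \<in> carrier T. lamp s \<noteq> \<one>\<^bsub>C\<^esub>}"
    by (rule finite_subset[of _ "{\<one>\<^bsub>T\<^esub>}"]) (auto simp: lamp_def)
  then have lamp: "lamp \<in> carrier N"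
    using c unfolding N_def carrier_wreath_base[OF assms(2,4)] by (auto simp: lamp_def)
  have "lamp \<one>\<^bsub>T\<^esub> \<noteq> \<one>\<^bsub>N\<^esub> \<one>\<^bsub>T\<^esub>" using c by (simp add: lamp_def N_def wreath_base_def)
  then have lamp_ne: "lamp \<noteq> \<one>\<^bsub>N\<^esub>" by auto
  \<comment> \<open>At each coordinate both values are \<open>c\<close> or the unit, so they commute
    even if \<open>C\<close> is not abelian.\<close>
  have lamp_commute: "translate C T t lamp \<otimes>\<^bsub>N\<^esub> lamp = lamp \<otimes>\<^bsub>N\<^esub> translate C T t lamp" if t: "t \<in> carrier T" for t
  proof (rule wreath_base_eqI[OF assms(2,4), folded N_def])
    fix s assume s: "s \<in> carrier T"
    have "translate C T t lamp s = lamp (inv\<^bsub>T\<^esub> t \<otimes>\<^bsub>T\<^esub> s)" 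
      by (rule translate_apply[OF lamp[unfolded N_def] s])
    then have "translate C T t lamp s \<otimes>\<^bsub>C\<^esub> lamp s = lamp s \<otimes>\<^bsub>C\<^esub> translate C T t lamp s"
      using s t c by (simp add: lamp_def)
    then show "(translate C T t lamp \<otimes>\<^bsub>N\<^esub> lamp) s = (lamp \<otimes>\<^bsub>N\<^esub> translate C T t lamp) s"
      using s by (simp add: N_def wreath_base_def)
  qed (use lamp t in simp_all)
  \<comment> \<open>A function invariant under \<open>t\<close> is constant along the orbit of a
    coordinate. Finite support makes this orbit finite, so \<open>t\<close> has finite order, while
    \<open>T\<close> is torsion-free because it acts faithfully on the line.\<close>
  have free: "b = \<one>\<^bsub>N\<^esub>"
    if t: "t \<in> carrier T" "t \<noteq> \<one>\<^bsub>T\<^esub>" and b: "b \<in> carrier N" "translate C T t b = b" for t b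
  proof (rule ccontr)
    assume "b \<noteq> \<one>\<^bsub>N\<^esub>"
    then obtain s where s: "s \<in> carrier T" "b s \<noteq> \<one>\<^bsub>N\<^esub> s"
      using wreath_base_eqI[OF assms(2,4) b(1)[unfolded N_def], of "\<one>\<^bsub>N\<^esub>"] N.one_closed by (auto simp: N_def)
    \<comment> \<open>Translation by \<open>t\<close> evaluates at the product with the inverse of
      \<open>t\<close>, so the powers of that inverse run along the orbit.\<close>
    define u where "u = inv\<^bsub>T\<^esub> t"
    have u: "u \<in> carrier T" using t by (simp add: u_def)
    have step: "b (u \<otimes>\<^bsub>T\<^esub> x) = b x" if "x \<in> carrier T" for x
      using translate_apply[OF b(1)[unfolded N_def] that, of t] b(2) by (simp add: u_def)
    have orbit: "b (u [^]\<^bsub>T\<^esub> n \<otimes>\<^bsub>T\<^esub> s) = b s" for n :: nat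
    proof (induction n)
      case (Suc n)
      have "u [^]\<^bsub>T\<^esub> Suc n \<otimes>\<^bsub>T\<^esub> s = u \<otimes>\<^bsub>T\<^esub> (u [^]\<^bsub>T\<^esub> n \<otimes>\<^bsub>T\<^esub> s)"
        using u s by (simp only: T.nat_pow_Suc2 T.m_assoc T.nat_pow_closed)
      then show ?case using Suc step[of "u [^]\<^bsub>T\<^esub> n \<otimes>\<^bsub>T\<^esub> s"] u s by simp
    qed (use s in simp)
    define pt where "pt n = u [^]\<^bsub>T\<^esub> n \<otimes>\<^bsub>T\<^esub> s" for n :: nat
    have "range pt \<subseteq> {x \<in> carrier T. b x \<noteq> \<one>\<^bsub>C\<^esub>}"
      using orbit s u by (auto simp: N_def wreath_base_def pt_def)
    moreover have "finite {x \<in> carrier T. b x \<noteq> \<one>\<^bsub>C\<^esub>}"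
      using b(1) unfolding N_def carrier_wreath_base[OF assms(2,4)] by simp
    ultimately have "finite (range pt)" by (rule finite_subset)
    then have "\<not> inj pt" using finite_imageD infinite_UNIV_nat by blast
    then obtain i j where "i < j" "pt i = pt j"
      unfolding inj_def using linorder_neqE_nat by metis
    then have ij: "i < j" "u [^]\<^bsub>T\<^esub> i \<otimes>\<^bsub>T\<^esub> s = u [^]\<^bsub>T\<^esub> j \<otimes>\<^bsub>T\<^esub> s"
      by (simp_all add: pt_def)
    then have eq: "u [^]\<^bsub>T\<^esub> i = u [^]\<^bsub>T\<^esub> j" using T.right_cancel[OF s(1) T.nat_pow_closed[OF u] T.nat_pow_closed[OF u]] by simp
    have "u [^]\<^bsub>T\<^esub> i \<otimes>\<^bsub>T\<^esub> u [^]\<^bsub>T\<^esub> (j - i) = u [^]\<^bsub>T\<^esub> j" using u ij by (simp add: T.nat_pow_mult)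
    then have "u [^]\<^bsub>T\<^esub> i \<otimes>\<^bsub>T\<^esub> u [^]\<^bsub>T\<^esub> (j - i) = u [^]\<^bsub>T\<^esub> i" using eq by simp
    then have "u [^]\<^bsub>T\<^esub> (j - i) = \<one>\<^bsub>T\<^esub>" using u by (simp add: T.l_cancel_one)
    then have "u = \<one>\<^bsub>T\<^esub>" by (rule top.torsion_free[OF u]) (use ij in simp)
    then show False using t by (simp add: u_def T.inv_eq_1_iff)
  qed
  interpret L: lamplighter "top ` carrier T" "base ` carrier N" "base lamp"
  proof unfold_locales
    show "homeo_group (top ` carrier T)" "homeo_group (base ` carrier N)"
      by (rule top.homeo_group_image base.homeo_group_image)+
    show "piecewise_affine t" if "t \<in> top ` carrier T" for t using that pl_E by (auto simp: top_def W_simps)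
    show "piecewise_affine b" if "b \<in> base ` carrier N" for b using that pl_E by (auto simp: base_def W_simps)
    show "t \<circ> b \<circ> inv_into UNIV t \<in> base ` carrier N"
      if "t \<in> top ` carrier T" "b \<in> base ` carrier N" for t b
      using that by (auto simp: conj simp del: fun.map_comp)
    show "b = id" if tb: "t \<in> top ` carrier T" "b \<in> base ` carrier N" "t \<circ> b = b \<circ> t" "t \<noteq> id" for t b
    proof -
      obtain t' b' where tb': "t = top t'" "t' \<in> carrier T" "b = base b'" "b' \<in> carrier N" using tb by blast
      have "t' \<noteq> \<one>\<^bsub>T\<^esub>" using tb tb' top.E_one by auto
      have "base (translate C T t' b') = b \<circ> t \<circ> inv_into UNIV t" using conj[OF tb'(2,4)] tb tb' by simp
      also have "\<dots> = base b'" using interval_homeos_simps(1)[OF top.E_homeo[OF tb'(2)]] tb' by auto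
      finally have "translate C T t' b' = b'" using base.E_eq_iff tb' by simp
      then show ?thesis using free[OF tb'(2) \<open>t' \<noteq> \<one>\<^bsub>T\<^esub>\<close> tb'(4)] base.E_one tb' by simp
    qed
    show "base lamp \<in> base ` carrier N" "base lamp \<noteq> id"
      using lamp lamp_ne base.E_eq_id_iff by auto
    show "inv_into UNIV t \<circ> base lamp \<circ> t \<circ> base lamp = base lamp \<circ> (inv_into UNIV t \<circ> base lamp \<circ> t)"
      if t: "t \<in> top ` carrier T" for t
    proof -
      obtain t' where t': "t = top t'" "t' \<in> carrier T" using t by blast
      have "inv_into UNIV t \<circ> base lamp \<circ> t = base (translate C T (inv\<^bsub>T\<^esub> t') lamp)"
        using conj[OF T.inv_closed[OF t'(2)] lamp] top.E_inv[OF T.inv_closed[OF t'(2)]] top.E_inv[OF t'(2)] t' by simp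
      then show ?thesis using base.E_mult lamp lamp_commute[OF T.inv_closed[OF t'(2)]] t' 
        by (metis T.inv_closed translate_closed[OF assms(2,4), folded N_def])
    qed
    show "\<exists>w\<in>top ` carrier T. w \<noteq> id" using w top.E_eq_id_iff by blast
  qed
  obtain v where v: "v \<in> carrier T"
    "\<And>t. t \<in> carrier T \<Longrightarrow> \<exists>n::nat. top t = top v ^^ n \<or> inv_into UNIV (top t) = top v ^^ n"
    using L.T_cyclic by blast
  show ?thesis
  proof (rule top.iso_integer_group[OF v(1) _ assms(5)])
    fix t assume t: "t \<in> carrier T"
    then obtain n :: nat where "top t = top v ^^ n \<or> inv_into UNIV (top t) = top v ^^ n" using v(2) by blast
    then have "top t = top (v [^]\<^bsub>T\<^esub> n) \<or> top (inv\<^bsub>T\<^esub> t) = top (v [^]\<^bsub>T\<^esub> n)"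
      using top.E_pow[OF v(1)] top.E_inv[OF t] by simp
    then show "\<exists>n::nat. t = v [^]\<^bsub>T\<^esub> n \<or> inv\<^bsub>T\<^esub> t = v [^]\<^bsub>T\<^esub> n"
      using top.E_eq_iff t v(1) by blast
  qed
qed

end
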